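(* Let $K$ be a field with a nontrivial valuation $\operatorname{val}:K^*\to\mathbb R$ whose value group $\Gamma=\operatorname{val}(K^* )\subseteq\mathbb R$ is dense in $\mathbb R$ and contains $\mathbb Q$, and assume that a splitting $\Gamma\to K^*$, $w\mapsto t^w$, of the valuation has been fixed. Let $I\subseteq K[x_0,\dots,x_n]$ be a homogeneous ideal. Then the collection $\{\overline{C_I[w]} : w\in\Gamma^{n+1}\}$ forms a finite $\Gamma$-rational polyhedral complex.
   Context: Notation: $R=\{a\in K: a=0 \text{ or } \operatorname{val}(a)\ge 0\}$ is the valuation ring, $\mathfrak m$ its maximal ideal, $\Bbbk=R/\mathfrak m$ the residue field, and $\overline a\in\Bbbk$ the image of $a\in R$. A splitting is a group homomorphism $\Gamma\to K^*$, $w\mapsto t^w$, with $\operatorname{val}(t^w)=w$. Initial forms and ideals: for a nonzero polynomial $f=\sum_u c_u x^u\in K[x_0,\dots,x_n]$ and $w\in\Gamma^{n+1}$, put $\operatorname{trop}(f)(w)=\min_{u:\,c_u\neq0}(\operatorname{val}(c_u)+w\cdot u)$ and, with $W=\operatorname{trop}(f)(w)$, $$\operatorname{in}_w(f)=\sum_{u:\ \operatorname{val}(c_u)+w\cdot u=W}\overline{t^{-\operatorname{val}(c_u)}c_u}\,x^u\in\Bbbk[x_0,\dots,x_n];$$ $\operatorname{in}_w(0)=0$. For an ideal $I$, $\operatorname{in}_w(I)$ is the ideal of $\Bbbk[x_0,\dots,x_n]$ generated by $\{\operatorname{in}_w(f): f\in I\}$. Define $C_I[w]=\{w'\in\Gamma^{n+1}:\operatorname{in}_{w'}(I)=\operatorname{in}_w(I)\}$,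 and let $\overline{C_I[w]}$ be its closure in $\mathbb R^{n+1}$ in the Euclidean topology. A polyhedral complex is a collection of polyhedra that contains all (nonempty) faces of any polyhedron in the collection and in which the intersection of any two polyhedra is either empty or a common face. A polyhedron $P\subseteq\mathbb R^{n+1}$ is $\Gamma$-rational if $P=\{x\in\mathbb R^{n+1}: Ax\le b\}$ for some $s\times(n+1)$ matrix $A$ with rational entries and some $b\in\Gamma^s$. A polyhedral complex is $\Gamma$-rational if all its polyhedra are.
   Formalization: The value group Γ is additionally assumed divisible; without this the claim fails, e.g. Γ = ℚ+ℤ√2 and I = (x₀² + t^{√2}x₁²), where the two half-plane cells meet in a line that is not in the collection. *)

theory Defs
  imports "HOL-Analysis.Analysis" "HOL-Library.Poly_Mapping"
begin

(* The value of val at 0 is left unspecified; every use below is guarded. *)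
class valued_field = field +
  fixes val :: "'a \<Rightarrow> real"
  assumes val_mult: "a \<noteq> 0 \<Longrightarrow> b \<noteq> 0 \<Longrightarrow> val (a * b) = val a + val b"
    and val_add: "a \<noteq> 0 \<Longrightarrow> b \<noteq> 0 \<Longrightarrow> a + b \<noteq> 0 \<Longrightarrow> min (val a) (val b) \<le> val (a + b)"

definition value_group :: "'a::valued_field itself \<Rightarrow> real set"
  where "value_group _ = val ` (UNIV - {0::'a})"

(* Reals outside the value group are mapped to arbitrary elements. *)
definition splitting :: "(real \<Rightarrow> 'a::valued_field) \<Rightarrow> bool"
  where "splitting t \<longleftrightarrow>
    (\<forall>w\<in>value_group TYPE('a). t w \<noteq> 0 \<and> val (t w) = w) \<and>
    (\<forall>v\<in>value_group TYPE('a). \<forall>w\<in>value_group TYPE('a). t (v + w) = t v * t w)"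

lemma val_one [simp]: "val (1::'a::valued_field) = 0"
  using val_mult[of "1::'a" 1] by simp

lemma val_inverse: "(a::'a::valued_field) \<noteq> 0 \<Longrightarrow> val (inverse a) = - val a"
  using val_mult[of a "inverse a"] by simp

lemma val_uminus [simp]: "val (- a) = val (a::'a::valued_field)"
proof (cases "a = 0")
  case False
  have "val (- 1 :: 'a) = 0"
    using val_mult[of "- 1 :: 'a" "- 1"] by simp
  then show ?thesis
    using val_mult[of "- 1 :: 'a" a] False by simp
qed simp


definition valuation_ring :: "'a::valued_field set"
  where "valuation_ring = {a. a = 0 \<or> val a \<ge> 0}"

definition maximal_ideal :: "'a::valued_field set"
  where "maximal_ideal = {a. a = 0 \<or> val a > 0}"

lemma valuation_ring_0 [simp]: "0 \<in> valuation_ring"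
  and valuation_ring_1 [simp]: "1 \<in> valuation_ring"
  and maximal_ideal_0 [simp]: "0 \<in> maximal_ideal"
  and maximal_ideal_1 [simp]: "1 \<notin> maximal_ideal"
  by (auto simp: valuation_ring_def maximal_ideal_def)

lemma maximal_ideal_subset: "a \<in> maximal_ideal \<Longrightarrow> a \<in> valuation_ring"
  by (auto simp: valuation_ring_def maximal_ideal_def)

lemma valuation_ring_uminus: "a \<in> valuation_ring \<Longrightarrow> - a \<in> valuation_ring"
  and maximal_ideal_uminus: "a \<in> maximal_ideal \<Longrightarrow> - a \<in> maximal_ideal"
  by (auto simp: valuation_ring_def maximal_ideal_def)

lemma valuation_ring_add:
  "a \<in> valuation_ring \<Longrightarrow> b \<in> valuation_ring \<Longrightarrow> a + b \<in> valuation_ring"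
  using val_add[of a b] by (cases "a = 0"; cases "b = 0"; cases "a + b = 0") (auto simp: valuation_ring_def)

lemma maximal_ideal_add:
  "a \<in> maximal_ideal \<Longrightarrow> b \<in> maximal_ideal \<Longrightarrow> a + b \<in> maximal_ideal"
  using val_add[of a b] by (cases "a = 0"; cases "b = 0"; cases "a + b = 0") (auto simp: maximal_ideal_def)

lemma valuation_ring_mult:
  "a \<in> valuation_ring \<Longrightarrow> b \<in> valuation_ring \<Longrightarrow> a * b \<in> valuation_ring"
  using val_mult[of a b] by (cases "a = 0"; cases "b = 0") (auto simp: valuation_ring_def)

lemma maximal_ideal_mult:
  "a \<in> valuation_ring \<Longrightarrow> b \<in> maximal_ideal \<Longrightarrow> a * b \<in> maximal_ideal"
  using val_mult[of a b] by (cases "a = 0"; cases "b = 0") (auto simp: valuation_ring_def maximal_ideal_def)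

lemma valuation_ring_inverse:
  "a \<in> valuation_ring \<Longrightarrow> a \<notin> maximal_ideal \<Longrightarrow> inverse a \<in> valuation_ring"
  using val_inverse[of a] by (auto simp: valuation_ring_def maximal_ideal_def)


(* The residue field R/m is obtained as a quotient type directly from K, by a
   partial equivalence relation whose domain is R and whose classes are the
   cosets of m. *)
definition residue_rel :: "'a::valued_field \<Rightarrow> 'a \<Rightarrow> bool"
  where "residue_rel a b \<longleftrightarrow>
    a \<in> valuation_ring \<and> b \<in> valuation_ring \<and> a - b \<in> maximal_ideal"

lemma part_equivp_residue_rel: "part_equivp residue_rel"
proof (rule part_equivpI)
  show "\<exists>x::'a. residue_rel x x"
    by (rule exI[of _ 0]) (simp add: residue_rel_def)
  show "symp (residue_rel :: 'a \<Rightarrow> _)"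
    by (rule sympI) (metis maximal_ideal_uminus minus_diff_eq residue_rel_def)
  show "transp (residue_rel :: 'a \<Rightarrow> _)"
  proof (rule transpI)
    fix a b c :: 'a
    assume "residue_rel a b" "residue_rel b c"
    then show "residue_rel a c"
      using maximal_ideal_add[of "a - b" "b - c"] by (auto simp: residue_rel_def)
  qed
qed

quotient_type (overloaded) 'a residue_field = "'a::valued_field" / partial: residue_rel
  by (rule part_equivp_residue_rel)

instantiation residue_field :: (valued_field) comm_ring_1
begin

lift_definition zero_residue_field :: "'a residue_field" is 0
  by (simp add: residue_rel_def)

lift_definition one_residue_field :: "'a residue_field" is 1
  by (simp add: residue_rel_def)

lift_definition plus_residue_field :: "'a residue_field \<Rightarrow> 'a residue_field \<Rightarrow> 'a residue_field"
  is "(+)"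
proof -
  fix a b c d :: 'a
  assume "residue_rel a b" "residue_rel c d"
  moreover have "a + c - (b + d) = (a - b) + (c - d)" by simp
  ultimately show "residue_rel (a + c) (b + d)"
    unfolding residue_rel_def by (metis valuation_ring_add maximal_ideal_add)
qed

lift_definition uminus_residue_field :: "'a residue_field \<Rightarrow> 'a residue_field"
  is uminus
proof -
  fix a b :: 'a
  assume "residue_rel a b"
  moreover have "- a - - b = - (a - b)" by simp
  ultimately show "residue_rel (- a) (- b)"
    unfolding residue_rel_def by (metis valuation_ring_uminus maximal_ideal_uminus)
qed

definition minus_residue_field :: "'a residue_field \<Rightarrow> 'a residue_field \<Rightarrow> 'a residue_field"
  where "minus_residue_field x y = x + - y"

lift_definition times_residue_field :: "'a residue_field \<Rightarrow> 'a residue_field \<Rightarrow> 'a residue_field"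
  is "(*)"
proof -
  fix a b c d :: 'a
  assume "residue_rel a b" "residue_rel c d"
  moreover have "a * c - b * d = c * (a - b) + b * (c - d)" by (simp add: algebra_simps)
  ultimately show "residue_rel (a * c) (b * d)"
    unfolding residue_rel_def
    by (metis valuation_ring_mult maximal_ideal_mult maximal_ideal_add)
qed

instance
proof
  fix x y z :: "'a residue_field"
  show "x + y + z = x + (y + z)"
    by transfer (simp add: residue_rel_def valuation_ring_add ac_simps)
  show "x + y = y + x"
    by transfer (simp add: residue_rel_def valuation_ring_add ac_simps)
  show "0 + x = x"
    by transfer (simp add: residue_rel_def)
  show "- x + x = 0"
    by transfer (simp add: residue_rel_def)
  show "x - y = x + - y"
    by (simp add: minus_residue_field_def)
  show "x * y * z = x * (y * z)"
    by transfer (simp add: residue_rel_def valuation_ring_mult ac_simps)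
  show "x * y = y * x"
    by transfer (simp add: residue_rel_def valuation_ring_mult ac_simps)
  show "1 * x = x"
    by transfer (simp add: residue_rel_def)
  show "(x + y) * z = x * z + y * z"
    by transfer
      (simp add: residue_rel_def valuation_ring_mult valuation_ring_add algebra_simps)
  show "(0::'a residue_field) \<noteq> 1"
    by transfer (metis residue_rel_def diff_0 maximal_ideal_uminus minus_minus maximal_ideal_1)
qed

end

instantiation residue_field :: (valued_field) field
begin

lift_definition inverse_residue_field :: "'a residue_field \<Rightarrow> 'a residue_field"
  is "\<lambda>a. if a \<in> maximal_ideal then 0 else inverse a"
proof -
  fix a b :: 'a
  assume ab: "residue_rel a b"
  then have iff: "a \<in> maximal_ideal \<longleftrightarrow> b \<in> maximal_ideal"
    using maximal_ideal_add[of "a - b" b] maximal_ideal_add[of "- (a - b)" a]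
      maximal_ideal_uminus[of "a - b"]
    by (auto simp: residue_rel_def)
  show "residue_rel (if a \<in> maximal_ideal then 0 else inverse a)
      (if b \<in> maximal_ideal then 0 else inverse b)"
  proof (cases "a \<in> maximal_ideal")
    case True
    then show ?thesis using iff by (simp add: residue_rel_def)
  next
    case False
    then have nz: "a \<noteq> 0" "b \<noteq> 0" using iff by auto
    have inv: "inverse a \<in> valuation_ring" "inverse b \<in> valuation_ring"
      using ab False iff by (auto simp: residue_rel_def intro: valuation_ring_inverse)
    have "inverse a - inverse b = - (inverse a * inverse b * (a - b))"
      using nz by (simp add: field_simps)
    then have "inverse a - inverse b \<in> maximal_ideal"
      using inv ab
      by (metis residue_rel_def valuation_ring_mult maximal_ideal_mult maximal_ideal_uminus)
    then show ?thesis using False iff inv by (simp add: residue_rel_def)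
  qed
qed

definition divide_residue_field :: "'a residue_field \<Rightarrow> 'a residue_field \<Rightarrow> 'a residue_field"
  where "divide_residue_field x y = x * inverse y"

instance
proof
  fix x y :: "'a residue_field"
  show "x div y = x * inverse y"
    by (rule divide_residue_field_def)
  show "inverse 0 = (0::'a residue_field)"
    by transfer (simp add: residue_rel_def)
  show "x \<noteq> 0 \<Longrightarrow> inverse x * x = 1"
  proof transfer
    fix a :: 'a
    assume "residue_rel a a" "\<not> residue_rel a 0"
    then have "a \<notin> maximal_ideal" by (simp add: residue_rel_def)
    moreover from this have "a \<noteq> 0" by auto
    ultimately show "residue_rel ((if a \<in> maximal_ideal then 0 else inverse a) * a) 1"
      by (simp add: residue_rel_def)
  qed
qed

end

(* Only meaningful for arguments in the valuation ring. *)
definition residue :: "'a::valued_field \<Rightarrow> 'a residue_field"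
  where "residue = abs_residue_field"

lemma residue_eq_iff:
  assumes "a \<in> valuation_ring" "b \<in> valuation_ring"
  shows "residue a = residue b \<longleftrightarrow> a - b \<in> maximal_ideal"
  using assms Quotient_rel[OF Quotient_residue_field, of a b]
  by (auto simp: residue_def residue_rel_def)

lemma residue_0: "residue 0 = 0"
  by (simp add: residue_def zero_residue_field_def)

lemma residue_1: "residue 1 = 1"
  by (simp add: residue_def one_residue_field_def)

lemma residue_add:
  "a \<in> valuation_ring \<Longrightarrow> b \<in> valuation_ring \<Longrightarrow> residue (a + b) = residue a + residue b"
  by (simp add: residue_def plus_residue_field.abs_eq residue_rel_def)

lemma residue_mult:
  "a \<in> valuation_ring \<Longrightarrow> b \<in> valuation_ring \<Longrightarrow> residue (a * b) = residue a * residue b"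
  by (simp add: residue_def times_residue_field.abs_eq residue_rel_def)

lemma residue_surj: "residue ` valuation_ring = UNIV"
proof -
  have "\<exists>a\<in>valuation_ring. x = residue a" for x :: "'a residue_field"
    by (induct x) (auto simp: residue_def residue_rel_def)
  then show ?thesis by blast
qed


(* A finite index type 'n with CARD('n) = n + 1 plays the role of {0,...,n};
   exponent vectors are finitely supported functions 'n => nat. *)
type_synonym ('n, 'a) mpoly = "('n \<Rightarrow>\<^sub>0 nat) \<Rightarrow>\<^sub>0 'a"

global_interpretation ideal: module "(*) :: 'r::comm_ring_1 \<Rightarrow> 'r \<Rightarrow> 'r"
  by unfold_locales (simp_all add: algebra_simps)

definition homogeneous :: "('n::finite, 'a::zero) mpoly \<Rightarrow> bool"
  where "homogeneous f \<longleftrightarrow>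
    (\<exists>d. \<forall>u\<in>Poly_Mapping.keys f. (\<Sum>i\<in>UNIV. Poly_Mapping.lookup u i) = d)"

(* The locale constant ideal.span is the ideal generated by a set. *)
definition homogeneous_ideal :: "('n::finite, 'a::field) mpoly set \<Rightarrow> bool"
  where "homogeneous_ideal I \<longleftrightarrow> (\<exists>H. (\<forall>h\<in>H. homogeneous h) \<and> I = ideal.span H)"

definition term_weight :: "real ^ 'n::finite \<Rightarrow> ('n, 'a::valued_field) mpoly \<Rightarrow> ('n \<Rightarrow>\<^sub>0 nat) \<Rightarrow> real"
  where "term_weight w f u =
    val (Poly_Mapping.lookup f u) + (\<Sum>i\<in>UNIV. w $ i * real (Poly_Mapping.lookup u i))"

definition trop :: "('n::finite, 'a::valued_field) mpoly \<Rightarrow> real ^ 'n \<Rightarrow> real"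
  where "trop f w = Min (term_weight w f ` Poly_Mapping.keys f)"

(* For f = 0 the sum is empty. *)
definition initial_form ::
    "(real \<Rightarrow> 'a::valued_field) \<Rightarrow> real ^ 'n::finite \<Rightarrow> ('n, 'a) mpoly \<Rightarrow> ('n, 'a residue_field) mpoly"
  where "initial_form t w f =
    (\<Sum>u | u \<in> Poly_Mapping.keys f \<and> term_weight w f u = trop f w.
      Poly_Mapping.single u
        (residue (t (- val (Poly_Mapping.lookup f u)) * Poly_Mapping.lookup f u)))"

definition initial_ideal ::
    "(real \<Rightarrow> 'a::valued_field) \<Rightarrow> real ^ 'n::finite \<Rightarrow> ('n, 'a) mpoly set \<Rightarrow> ('n, 'a residue_field) mpoly set"
  where "initial_ideal t w I = ideal.span (initial_form t w ` I)"

definition value_points :: "'a::valued_field itself \<Rightarrow> (real ^ 'n::finite) set"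
  where "value_points K = {w. \<forall>i. w $ i \<in> value_group K}"

definition groebner_class ::
    "(real \<Rightarrow> 'a::valued_field) \<Rightarrow> ('n::finite, 'a) mpoly set \<Rightarrow> real ^ 'n \<Rightarrow> (real ^ 'n) set"
  where "groebner_class t I w =
    {w' \<in> value_points TYPE('a). initial_ideal t w' I = initial_ideal t w I}"

definition groebner_cells ::
    "(real \<Rightarrow> 'a::valued_field) \<Rightarrow> ('n::finite, 'a) mpoly set \<Rightarrow> (real ^ 'n) set set"
  where "groebner_cells t I = {closure (groebner_class t I w) | w. w \<in> value_points TYPE('a)}"

definition polyhedral_complex :: "'v::euclidean_space set set \<Rightarrow> bool"
  where "polyhedral_complex \<C> \<longleftrightarrow>
    (\<forall>P\<in>\<C>. polyhedron P) \<and>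
    (\<forall>P\<in>\<C>. \<forall>F. F face_of P \<and> F \<noteq> {} \<longrightarrow> F \<in> \<C>) \<and>
    (\<forall>P\<in>\<C>. \<forall>Q\<in>\<C>. P \<inter> Q = {} \<or> (P \<inter> Q) face_of P \<and> (P \<inter> Q) face_of Q)"

(* The s rows of the matrix A are A 0, ..., A (s - 1). *)
definition rational_polyhedron :: "real set \<Rightarrow> (real ^ 'n::finite) set \<Rightarrow> bool"
  where "rational_polyhedron \<Gamma> P \<longleftrightarrow>
    (\<exists>(s::nat) (A :: nat \<Rightarrow> real ^ 'n) (b :: nat \<Rightarrow> real).
      (\<forall>i<s. (\<forall>j. A i $ j \<in> \<rat>) \<and> b i \<in> \<Gamma>) \<and>
      P = {x. \<forall>i<s. (\<Sum>j\<in>UNIV. A i $ j * x $ j) \<le> b i})"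

(* Closedness under faces fails for a value group that is not divisible: if
   c has value g but g/2 is not in the value group, the ideal generated by
   x_0^2 + c x_1^2 gives exactly the two half-planes bounded by the line
   x_0 - x_1 = g/2, while that line contains no point with coordinates in the
   value group and so is not the closure of a class. *)
definition divisible :: "real set \<Rightarrow> bool"
  where "divisible \<Gamma> \<longleftrightarrow> (\<forall>g\<in>\<Gamma>. \<forall>m::nat. m > 0 \<longrightarrow> g / real m \<in> \<Gamma>)"

end

(* Every w singles out, via the pair (weight, tie-break by a fixed rank), a leading exponent of each
   nonzero polynomial of I; let M be the set of these exponents. Gaussian elimination in each degree
   gives, for u in M, a polynomial f_u in I equal to x^u plus terms outside of M. The f_u with u
   in a finite generating set of M impose finitely many conditions
   val(c_v) + w.v >= w.u, and on their solution set in_w(I) is spanned by the initial forms of the f_u,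
   so that its Groebner class is determined by which of the conditions are tight. By Dickson's lemma
   only finitely many M occur. The faces and intersections of the resulting polyhedra are
   handled by density of the points with coordinates in the value group in relatively open
   polyhedra with rational slopes and constants in the value group. *)

theory Submission
  imports Defs "HOL-Computational_Algebra.Primes"
begin

section \<open>Cells of a finite system of affine constraints\<close>

text \<open>Division with remainder need not stop over a valued field: reducing x by x - p y and y -
  p x, with val(p) > 0 and equal weights, gives p y, p^2 x, and so on. Homogeneity replaces
  termination, since each degree is a finite-dimensional problem of linear algebra. The sets M are
  attached to all real w, because a comparison of w with another solution runs along a segment that
  leaves the \<Gamma>-points. The conditions belonging to M describe the class of every
  \<Gamma>-point of their solution set, including boundary points whose own set of leading exponents
  is another one; hence the faces of a cell come from the same system, and two systems give the same
  cell at a common point. Density of \<Gamma> in the line alone yields no \<Gamma>-points on a face.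
  They come from a rational-linear map of the reals onto \<Gamma> that is the identity on \<Gamma>
  and moves the coordinates of a given point only slightly: it respects every equation with rational
  slopes and constants in \<Gamma>.\<close>

definition constraint_value :: "'v::real_inner \<times> real \<Rightarrow> 'v \<Rightarrow> real"
  where "constraint_value c x = fst c \<bullet> x + snd c"

definition solutions :: "('v::real_inner \<times> real) set \<Rightarrow> 'v set"
  where "solutions H = {x. \<forall>c\<in>H. 0 \<le> constraint_value c x}"

definition tight :: "('v::real_inner \<times> real) set \<Rightarrow> 'v \<Rightarrow> ('v \<times> real) set"
  where "tight H x = {c \<in> H. constraint_value c x = 0}"

text \<open>For finite \<open>H\<close> and a solution \<open>x\<close>, this is the smallest face
  of the polyhedron \<open>solutions H\<close> that contains \<open>x\<close>.\<close>

definition cell :: "('v::real_inner \<times> real) set \<Rightarrow> 'v \<Rightarrow> 'v set"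
  where "cell H x = {y \<in> solutions H. tight H x \<subseteq> tight H y}"

lemma constraint_value_combination:
  "constraint_value c ((1 - s) *\<^sub>R x + s *\<^sub>R y) =
    (1 - s) * constraint_value c x + s * constraint_value c y"
  by (simp add: constraint_value_def inner_add_right algebra_simps)

lemma mem_cell_iff:
  "y \<in> cell H x \<longleftrightarrow>
    (\<forall>c\<in>H. 0 \<le> constraint_value c y \<and> (constraint_value c x = 0 \<longrightarrow> constraint_value c y = 0))"
  by (auto simp: cell_def solutions_def tight_def)

lemma self_mem_cell: "x \<in> solutions H \<Longrightarrow> x \<in> cell H x"
  by (simp add: cell_def)

lemma cell_cong: "tight H x = tight H y \<Longrightarrow> cell H x = cell H y"
  by (simp add: cell_def)

lemma constraint_value_halfspace:
  "{x. 0 \<le> constraint_value c x} = {x. fst c \<bullet> x \<ge> - snd c}"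
  by (auto simp: constraint_value_def)

lemma constraint_value_hyperplane:
  "{x. constraint_value c x = 0} = {x. fst c \<bullet> x = - snd c}"
  by (auto simp: constraint_value_def)

lemma cell_eq_Inter:
  "cell H x = \<Inter> ((\<lambda>c. {y. 0 \<le> constraint_value c y}) ` H \<union>
    (\<lambda>c. {y. constraint_value c y = 0}) ` tight H x)"
  by (auto simp: cell_def solutions_def tight_def)

lemma polyhedron_cell:
  fixes x :: "'v::euclidean_space"
  assumes "finite H"
  shows "polyhedron (cell H x)"
  unfolding cell_eq_Inter
proof (rule polyhedron_Inter)
  show "finite ((\<lambda>c. {y. 0 \<le> constraint_value c y}) ` H \<union>
      (\<lambda>c. {y. constraint_value c y = 0}) ` tight H x)"
    using assms by (simp add: tight_def)
qed (auto simp: constraint_value_halfspace constraint_value_hyperplane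
    polyhedron_halfspace_ge polyhedron_hyperplane)

lemma convex_cell: "convex (cell H x)"
  unfolding cell_eq_Inter
  by (rule convex_Inter)
    (auto simp: constraint_value_halfspace constraint_value_hyperplane
      convex_halfspace_ge convex_hyperplane)

lemma closed_cell: "closed (cell H x)"
  unfolding cell_eq_Inter
  by (rule closed_Inter)
    (auto simp: constraint_value_halfspace constraint_value_hyperplane
      closed_halfspace_ge closed_hyperplane)

text \<open>An affine function that is nonnegative at both ends of a segment and zero at an inner
  point is zero at both ends.\<close>

lemma cell_face_of:
  assumes "y \<in> cell H x"
  shows "cell H y face_of cell H x"
  unfolding face_of_def
proof (intro conjI ballI impI)
  show "cell H y \<subseteq> cell H x"
    using assms by (auto simp: cell_def)
  show "convex (cell H y)"
    by (rule convex_cell)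
  fix a b p
  assume ab: "a \<in> cell H x" "b \<in> cell H x" and p: "p \<in> cell H y" "p \<in> open_segment a b"
  then obtain s where s: "0 < s" "s < 1" "p = (1 - s) *\<^sub>R a + s *\<^sub>R b"
    by (auto simp: in_segment)
  have "constraint_value c a = 0 \<and> constraint_value c b = 0"
    if c: "c \<in> H" "constraint_value c y = 0" for c
  proof -
    have "(1 - s) * constraint_value c a + s * constraint_value c b = 0"
      using p(1) c s(3) by (auto simp: mem_cell_iff constraint_value_combination)
    moreover have "0 \<le> constraint_value c a" "0 \<le> constraint_value c b"
      using ab c(1) by (auto simp: mem_cell_iff)
    ultimately show ?thesis
      using s by (simp add: add_nonneg_eq_0_iff)
  qed
  then show "a \<in> cell H y" "b \<in> cell H y"
    using ab by (auto simp: mem_cell_iff)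
qed

lemma finite_positive_minimum:
  fixes f :: "'a \<Rightarrow> real"
  assumes "finite A" "\<And>x. x \<in> A \<Longrightarrow> 0 < f x"
  obtains e where "0 < e" "\<And>x. x \<in> A \<Longrightarrow> e \<le> f x"
proof
  show "0 < Min (insert 1 (f ` A))"
    using assms by simp
  show "Min (insert 1 (f ` A)) \<le> f x" if "x \<in> A" for x
    using assms that by simp
qed

text \<open>The point \<open>p\<close> is in the relative interior of its own cell: constraints
  tight at \<open>p\<close> vanish along the line through \<open>z\<close> and \<open>p\<close>, and
  the finitely many others have slack at \<open>p\<close>.\<close>

lemma cell_extend_segment:
  assumes "finite H" "p \<in> solutions H" "z \<in> cell H p"
  obtains e where "0 < e" "p + e *\<^sub>R (p - z) \<in> cell H p"
proof -
  let ?A = "{c \<in> H. constraint_value c p \<noteq> 0}"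
  \<comment> \<open>For \<open>e\<close> up to this quotient,
    \<open>e * constraint_value c z\<close> does not exceed the slack at \<open>p\<close>; the added
    1 avoids a zero denominator.\<close>
  let ?f = "\<lambda>c. constraint_value c p / (1 + \<bar>constraint_value c z\<bar>)"
  have "0 < ?f c" if "c \<in> ?A" for c
  proof -
    have "0 < constraint_value c p" using that assms(2) by (auto simp: solutions_def less_le)
    then show ?thesis by (intro divide_pos_pos) auto
  qed
  then obtain e where e: "0 < e" "\<And>c. c \<in> ?A \<Longrightarrow> e \<le> ?f c"
    using finite_positive_minimum[of ?A ?f] assms(1) by auto
  have val: "constraint_value c (p + e *\<^sub>R (p - z)) =
      (1 + e) * constraint_value c p - e * constraint_value c z" for c
    by (simp add: constraint_value_def inner_add_right inner_diff_right algebra_simps)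
  have "p + e *\<^sub>R (p - z) \<in> cell H p"
    unfolding mem_cell_iff
  proof (intro ballI conjI impI)
    fix c assume c: "c \<in> H"
    show "constraint_value c (p + e *\<^sub>R (p - z)) = 0" if "constraint_value c p = 0"
      using that c assms(3) by (simp add: val mem_cell_iff)
    show "0 \<le> constraint_value c (p + e *\<^sub>R (p - z))"
    proof (cases "constraint_value c p = 0")
      case False
      have "e * constraint_value c z \<le> e * (1 + \<bar>constraint_value c z\<bar>)"
        using e(1) by (intro mult_left_mono) auto
      also have "\<dots> \<le> constraint_value c p"
        using e(2)[of c] False c by (simp add: pos_le_divide_eq)
      also have "\<dots> \<le> (1 + e) * constraint_value c p"
        using e(1) assms(2) c by (simp add: solutions_def algebra_simps)
      finally show ?thesis by (simp add: val)
    qed (use c assms(3) in \<open>simp add: val mem_cell_iff\<close>)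
  qed
  with e(1) that show thesis by blast
qed

text \<open>The face \<open>cell H p\<close> meets the relative interior of \<open>F\<close>, hence
  contains \<open>F\<close>. Conversely, a segment from a point \<open>z\<close> of
  \<open>cell H p\<close> can be prolonged beyond \<open>p\<close>, and a face containing the inner
  point \<open>p\<close> contains the end \<open>z\<close>.\<close>

lemma face_of_cell_eq:
  fixes x :: "'v::euclidean_space"
  assumes "finite H" and F: "F face_of cell H x" and p: "p \<in> rel_interior F"
  shows "F = cell H p"
proof
  have pF: "p \<in> F" using p rel_interior_subset by blast
  then have px: "p \<in> cell H x" using F face_of_imp_subset by blast
  then have psol: "p \<in> solutions H" by (simp add: cell_def)
  show "F \<subseteq> cell H p"
    by (rule subset_of_face_of[OF cell_face_of[OF px] face_of_imp_subset[OF F]])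
      (use p self_mem_cell[OF psol] in blast)
  show "cell H p \<subseteq> F"
  proof
    fix z assume z: "z \<in> cell H p"
    show "z \<in> F"
    proof (cases "z = p")
      case False
      obtain e where e: "0 < e" "p + e *\<^sub>R (p - z) \<in> cell H p"
        using cell_extend_segment[OF assms(1) psol z] .
      let ?q = "p + e *\<^sub>R (p - z)"
      have sub: "cell H p \<subseteq> cell H x"
        using cell_face_of[OF px] face_of_imp_subset by blast
      have eq: "p = (1 - 1 / (1 + e)) *\<^sub>R z + (1 / (1 + e)) *\<^sub>R ?q"
      proof -
        have "(1 + e) *\<^sub>R p = e *\<^sub>R z + ?q"
          by (simp add: algebra_simps)
        then have "p = (1 / (1 + e)) *\<^sub>R (e *\<^sub>R z + ?q)"
          using e(1) by (metis (no_types, opaque_lifting) add_pos_pos less_irrefl nonzero_divide_eq_eq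
              scaleR_one scaleR_scaleR zero_less_one)
        moreover have "1 - 1 / (1 + e) = e / (1 + e)"
          using e(1) by (simp add: field_simps)
        ultimately show ?thesis by (simp add: scaleR_add_right)
      qed
      have "z \<noteq> ?q"
      proof
        assume "z = ?q"
        then have "(1 + e) *\<^sub>R (p - z) = 0" by (simp add: algebra_simps)
        then show False using e(1) False by simp
      qed
      then have "p \<in> open_segment z ?q"
        unfolding in_segment using eq e(1) by (intro conjI exI[of _ "1 / (1 + e)"]) auto
      then show ?thesis
        using F pF z e(2) sub unfolding face_of_def by blast
    qed (use pF in simp)
  qed
qed

lemma solutions_Un: "solutions (H \<union> H') = solutions H \<inter> solutions H'"
  by (auto simp: solutions_def)

text \<open>A function zero at \<open>p\<close> and positive at \<open>z\<close> would become
  negative beyond \<open>p\<close>. As \<open>c\<close> may lie outside of \<open>H\<close>, this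
  later carries tightness from the conditions for generators to those for all leading
  exponents.\<close>

lemma affine_vanishing_on_cell:
  assumes "finite H" "p \<in> solutions H" "z \<in> cell H p"
    and nonneg: "\<And>y. y \<in> solutions H \<Longrightarrow> 0 \<le> constraint_value c y"
    and zero: "constraint_value c p = 0"
  shows "constraint_value c z = 0"
proof -
  obtain e where e: "0 < e" "p + e *\<^sub>R (p - z) \<in> cell H p"
    using cell_extend_segment[OF assms(1-3)] .
  have "0 \<le> constraint_value c (p + e *\<^sub>R (p - z))" "0 \<le> constraint_value c z"
    using nonneg e(2) assms(3) by (auto simp: cell_def)
  moreover have "constraint_value c (p + e *\<^sub>R (p - z)) =
      (1 + e) * constraint_value c p - e * constraint_value c z"
    by (simp add: constraint_value_def inner_add_right inner_diff_right algebra_simps)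
  ultimately show ?thesis
    using zero e(1) by (simp add: mult_le_0_iff)
qed

section \<open>Divisible value groups as rational subspaces of the reals\<close>

locale rational_subspace =
  fixes \<Gamma> :: "real set"
  assumes add_mem: "x \<in> \<Gamma> \<Longrightarrow> y \<in> \<Gamma> \<Longrightarrow> x + y \<in> \<Gamma>"
    and uminus_mem: "x \<in> \<Gamma> \<Longrightarrow> - x \<in> \<Gamma>"
    and Rats_subset: "\<rat> \<subseteq> \<Gamma>"
    and divisible: "divisible \<Gamma>"
begin

lemma zero_mem: "0 \<in> \<Gamma>"
  using Rats_subset by auto

lemma diff_mem: "x \<in> \<Gamma> \<Longrightarrow> y \<in> \<Gamma> \<Longrightarrow> x - y \<in> \<Gamma>"
  using add_mem[of x "- y"] uminus_mem by simp

lemma nat_mult_mem: "x \<in> \<Gamma> \<Longrightarrow> real n * x \<in> \<Gamma>"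
  by (induct n) (auto simp: zero_mem add_mem algebra_simps)

lemma int_mult_mem: "x \<in> \<Gamma> \<Longrightarrow> real_of_int k * x \<in> \<Gamma>"
  using nat_mult_mem[of x "nat \<bar>k\<bar>"] uminus_mem[of "real (nat \<bar>k\<bar>) * x"]
  by (cases "0 \<le> k") auto

lemma Rats_mult_mem:
  assumes "q \<in> \<rat>" "x \<in> \<Gamma>"
  shows "q * x \<in> \<Gamma>"
proof -
  obtain k n where q: "q = real_of_int k / real n" "n \<noteq> 0"
    using assms(1) unfolding Rats_eq_int_div_nat by blast
  have "x / real n \<in> \<Gamma>"
    using divisible assms(2) q(2) unfolding divisible_def by simp
  from int_mult_mem[OF this, of k] show ?thesis
    by (simp add: q)
qed

lemma sum_mem: "(\<And>i. i \<in> A \<Longrightarrow> f i \<in> \<Gamma>) \<Longrightarrow> sum f A \<in> \<Gamma>"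
  by (induct A rule: infinite_finite_induct) (auto simp: zero_mem add_mem)

end

section \<open>Density of points with coordinates in the value group\<close>

global_interpretation rat_space: vector_space "\<lambda>(q::rat) (x::real). of_rat q * x"
  by unfold_locales (simp_all only: of_rat_add of_rat_mult distrib_left distrib_right mult.assoc of_rat_1 mult_1_left)

global_interpretation rat_space_pair: vector_space_pair
  "\<lambda>(q::rat) (x::real). of_rat q * x" "\<lambda>(q::rat) (x::real). of_rat q * x"
  by (intro vector_space_pair.intro rat_space.vector_space_axioms)

context rational_subspace
begin

lemma subspace: "rat_space.subspace \<Gamma>"
  by (rule rat_space.subspaceI) (simp_all add: zero_mem add_mem Rats_mult_mem)

text \<open>A Hamel basis of \<open>\<Gamma>\<close> is extended to one of the reals, and each additional basis
  vector is sent to a nearby rational number.\<close>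

lemma rational_linear_retraction:
  fixes X :: "real set"
  assumes "finite X" "0 < e"
  obtains \<phi> where
    "\<And>x y. \<phi> (x + y) = \<phi> x + \<phi> y" "\<And>q x. q \<in> \<rat> \<Longrightarrow> \<phi> (q * x) = q * \<phi> x"
    "\<And>x. \<phi> x \<in> \<Gamma>" "\<And>x. x \<in> \<Gamma> \<Longrightarrow> \<phi> x = x" "\<And>x. x \<in> X \<Longrightarrow> \<bar>\<phi> x - x\<bar> < e"
proof -
  obtain B0 where B0: "B0 \<subseteq> \<Gamma>" "rat_space.independent B0" "\<Gamma> \<subseteq> rat_space.span B0"
    using rat_space.maximal_independent_subset[of \<Gamma>] .
  obtain B where B: "B0 \<subseteq> B" "rat_space.independent B" "UNIV \<subseteq> rat_space.span B"
    using rat_space.maximal_independent_subset_extend[OF subset_UNIV B0(2)] .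
  define r where "r x b = real_of_rat (rat_space.representation B x b)" for x b
  define supp where "supp x = {b. rat_space.representation B x b \<noteq> 0}" for x
  have finite_supp: "finite (supp x)" for x
    unfolding supp_def by (rule rat_space.finite_representation)
  \<comment> \<open>A common bound for the sum of the absolute coordinates of each \<open>x\<close>
    in \<open>X\<close>; an error of at most \<open>d\<close> on every basis vector then costs less
    than \<open>e\<close> on \<open>x\<close>.\<close>
  define N where "N = (\<Sum>x\<in>X. \<Sum>b\<in>supp x. \<bar>r x b\<bar>)"
  have N: "0 \<le> N" unfolding N_def by (intro sum_nonneg) auto
  define d where "d = e / (N + 1)"
  have d: "0 < d" using N assms(2) by (simp add: d_def)
  have "\<exists>q\<in>\<rat>. \<bar>q - b\<bar> < d" for b :: real
  proof -
    obtain q where "q \<in> \<rat>" "b < q" "q < b + d"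
      using Rats_dense_in_real[of b "b + d"] d by auto
    then show ?thesis by (intro bexI[of _ q]) auto
  qed
  then obtain a where a: "\<And>b. a b \<in> \<rat>" "\<And>b. \<bar>a b - b\<bar> < d" by metis
  define g where "g b = (if b \<in> B0 then b else a b)" for b
  have g: "g b \<in> \<Gamma>" "\<bar>g b - b\<bar> \<le> d" for b
    using a[of b] B0(1) Rats_subset d by (auto simp: g_def)
  define \<phi> where "\<phi> = rat_space_pair.construct B g"
  interpret \<phi>: Vector_Spaces.linear "\<lambda>(q::rat) (x::real). of_rat q * x"
      "\<lambda>(q::rat) (x::real). of_rat q * x" \<phi>
    unfolding \<phi>_def by (rule rat_space_pair.linear_construct[OF B(2)])
  have basis: "\<phi> b = g b" if "b \<in> B" for b
    unfolding \<phi>_def by (rule rat_space_pair.construct_basis[OF B(2) that])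
  show thesis
  proof
    show "\<phi> (x + y) = \<phi> x + \<phi> y" for x y by (rule \<phi>.add)
    show "\<phi> (q * x) = q * \<phi> x" if "q \<in> \<rat>" for q x
    proof -
      obtain r where "q = of_rat r" using \<open>q \<in> \<rat>\<close> by (rule Rats_cases)
      then show ?thesis by (simp add: \<phi>.scale)
    qed
    show "\<phi> x \<in> \<Gamma>" for x
      using rat_space_pair.construct_in_span[OF B(2), of g x]
        rat_space.span_minimal[OF _ subspace, of "g ` B"] g(1)
      unfolding \<phi>_def by blast
    show "\<phi> x = x" if "x \<in> \<Gamma>" for x
    proof (rule rat_space_pair.linear_eq_on[of \<phi> "\<lambda>x. x" x B0])
      show "Vector_Spaces.linear (\<lambda>q. (*) (real_of_rat q)) (\<lambda>q. (*) (real_of_rat q)) \<phi>"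
        by (rule \<phi>.linear_axioms)
      show "Vector_Spaces.linear (\<lambda>q. (*) (real_of_rat q)) (\<lambda>q. (*) (real_of_rat q)) (\<lambda>x. x)"
        by (rule rat_space.linear_ident)
      show "x \<in> rat_space.span B0" using that B0(3) by blast
      show "\<phi> b = b" if "b \<in> B0" for b
        using that B(1) basis by (auto simp: g_def)
    qed
    show "\<bar>\<phi> x - x\<bar> < e" if "x \<in> X" for x
    proof -
      have x: "(\<Sum>b\<in>supp x. r x b * b) = x"
        unfolding supp_def r_def
        by (rule rat_space.sum_nonzero_representation_eq[OF B(2)]) (use B(3) in auto)
      have suppB: "supp x \<subseteq> B"
        unfolding supp_def by (auto dest: rat_space.representation_ne_zero)
      have "\<phi> x = (\<Sum>b\<in>supp x. \<phi> (r x b * b))"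
        by (subst x[symmetric]) (rule \<phi>.sum)
      also have "\<dots> = (\<Sum>b\<in>supp x. r x b * g b)"
        using suppB by (intro sum.cong refl) (auto simp: r_def \<phi>.scale basis)
      finally have "\<phi> x - x = (\<Sum>b\<in>supp x. r x b * g b) - (\<Sum>b\<in>supp x. r x b * b)"
        using x by simp
      also have "\<dots> = (\<Sum>b\<in>supp x. r x b * (g b - b))"
        by (simp add: sum_subtractf algebra_simps)
      finally have "\<bar>\<phi> x - x\<bar> \<le> (\<Sum>b\<in>supp x. \<bar>r x b * (g b - b)\<bar>)"
        by (metis sum_abs)
      also have "\<dots> \<le> (\<Sum>b\<in>supp x. \<bar>r x b\<bar> * d)"
        using g(2) by (intro sum_mono) (auto simp: abs_mult intro: mult_left_mono)
      also have "\<dots> = (\<Sum>b\<in>supp x. \<bar>r x b\<bar>) * d"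
        by (simp add: sum_distrib_right)
      also have "\<dots> \<le> N * d"
        unfolding N_def using that assms(1) d
        by (intro mult_right_mono member_le_sum) (auto intro!: sum_nonneg)
      also have "\<dots> < (N + 1) * d" using d by simp
      also have "\<dots> = e" using N by (simp add: d_def)
      finally show ?thesis .
    qed
  qed
qed

definition points :: "(real ^ 'n::finite) set"
  where "points = {w. \<forall>i. w $ i \<in> \<Gamma>}"

definition rational_constraints :: "((real ^ 'n::finite) \<times> real) set \<Rightarrow> bool"
  where "rational_constraints H \<longleftrightarrow> (\<forall>c\<in>H. (\<forall>i. fst c $ i \<in> \<rat>) \<and> snd c \<in> \<Gamma>)"

text \<open>The retraction is applied to each coordinate. It respects sums and rational multiples
  and fixes \<Gamma>, so it sends the value of a constraint at \<open>x\<close> to its value at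
  \<open>y\<close>.\<close>

lemma points_dense_on_constraints:
  fixes x :: "real ^ 'n::finite"
  assumes H: "rational_constraints H" and e: "0 < e"
  obtains y where "y \<in> points" "dist y x < e"
    "\<And>c. c \<in> H \<Longrightarrow> constraint_value c x = 0 \<Longrightarrow> constraint_value c y = 0"
proof -
  let ?n = "real CARD('n)"
  have pos: "0 < e / ?n" using e by simp
  obtain \<phi> where \<phi>: "\<And>x y. \<phi> (x + y) = \<phi> x + \<phi> y" "\<And>q x. q \<in> \<rat> \<Longrightarrow> \<phi> (q * x) = q * \<phi> x"
    "\<And>x. \<phi> x \<in> \<Gamma>" "\<And>x. x \<in> \<Gamma> \<Longrightarrow> \<phi> x = x"
    "\<And>z. z \<in> range (($) x) \<Longrightarrow> \<bar>\<phi> z - z\<bar> < e / ?n"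
    by (rule rational_linear_retraction[OF finite_imageI[of _ "($) x", OF finite_class.finite_UNIV] pos])
      (rule that, assumption+)
  define y where "y = (\<chi> i. \<phi> (x $ i))"
  have sum: "\<phi> (sum f A) = (\<Sum>i\<in>A. \<phi> (f i))" for f :: "'n \<Rightarrow> real" and A
    by (induct A rule: infinite_finite_induct) (use \<phi>(1,4) zero_mem in auto)
  show thesis
  proof
    show "y \<in> points" by (simp add: points_def y_def \<phi>(3))
    have "dist y x \<le> (\<Sum>i\<in>UNIV. \<bar>(y - x) $ i\<bar>)"
      unfolding dist_norm by (rule norm_le_l1_cart)
    also have "\<dots> < (\<Sum>i\<in>(UNIV::'n set). e / ?n)"
      by (rule sum_strict_mono) (auto simp: y_def \<phi>(5))
    finally show "dist y x < e" by simp
    fix c assume c: "c \<in> H" "constraint_value c x = 0"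
    then have rat: "\<And>i. fst c $ i \<in> \<rat>" "snd c \<in> \<Gamma>"
      using H by (auto simp: rational_constraints_def)
    have "0 = \<phi> (constraint_value c x)" using c(2) \<phi>(4) zero_mem by simp
    also have "\<dots> = \<phi> (\<Sum>i\<in>UNIV. fst c $ i * x $ i) + \<phi> (snd c)"
      by (simp add: constraint_value_def inner_vec_def \<phi>(1))
    also have "\<dots> = constraint_value c y"
      by (simp add: sum \<phi>(2) rat \<phi>(4) constraint_value_def inner_vec_def y_def)
    finally show "constraint_value c y = 0" by simp
  qed
qed

text \<open>Equations tight at \<open>x\<close> survive exactly by
  \<open>points_dense_on_constraints\<close>; the finitely many strict inequalities survive because
  \<open>y\<close> is close to \<open>x\<close>.\<close>

lemma points_dense_in_relative_interior:
  fixes x :: "real ^ 'n::finite"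
  assumes "finite H" "rational_constraints H" "x \<in> solutions H" "0 < e"
  obtains y where "y \<in> points" "y \<in> solutions H" "dist y x < e" "tight H y = tight H x"
proof -
  let ?A = "{c \<in> H. constraint_value c x \<noteq> 0}"
  \<comment> \<open>By Cauchy-Schwarz \<open>norm (fst c)\<close> is a Lipschitz constant of the
    constraint; the added 1 keeps the denominator positive.\<close>
  let ?f = "\<lambda>c. constraint_value c x / (1 + norm (fst c))"
  have "0 < ?f c" if "c \<in> ?A" for c
  proof -
    have "0 < constraint_value c x" using that assms(3) by (auto simp: solutions_def less_le)
    then show ?thesis by (intro divide_pos_pos add_pos_nonneg) auto
  qed
  then obtain d where d: "0 < d" "\<And>c. c \<in> ?A \<Longrightarrow> d \<le> ?f c"
    using finite_positive_minimum[of ?A ?f] assms(1) by auto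
  obtain y where y: "y \<in> points" "dist y x < min d e"
    "\<And>c. c \<in> H \<Longrightarrow> constraint_value c x = 0 \<Longrightarrow> constraint_value c y = 0"
    using points_dense_on_constraints[OF assms(2), of "min d e" x] d(1) assms(4) by auto
  have pos: "0 < constraint_value c y" if "c \<in> ?A" for c
  proof -
    have "\<bar>constraint_value c y - constraint_value c x\<bar> = \<bar>fst c \<bullet> (y - x)\<bar>"
      by (simp add: constraint_value_def inner_diff_right)
    also have "\<dots> \<le> norm (fst c) * dist y x"
      unfolding dist_norm by (rule Cauchy_Schwarz_ineq2)
    also have "\<dots> \<le> (1 + norm (fst c)) * dist y x"
      by (intro mult_right_mono) auto
    also have "\<dots> < (1 + norm (fst c)) * d"
      using y(2) by (intro mult_strict_left_mono add_pos_nonneg) auto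
    also have "\<dots> \<le> constraint_value c x"
      using d(2)[OF that] by (simp add: pos_le_divide_eq add_pos_nonneg mult.commute)
    finally show ?thesis by linarith
  qed
  show thesis
  proof
    show "y \<in> points" "dist y x < e" using y by auto
    show "y \<in> solutions H"
      using pos y(3) by (fastforce simp: solutions_def intro: less_imp_le)
    show "tight H y = tight H x"
      using pos y(3) by (fastforce simp: tight_def)
  qed
qed

text \<open>A point \<open>z\<close> of the cell is first moved slightly towards \<open>x\<close>,
  after which exactly the constraints tight at \<open>x\<close> are tight, and then approximated
  within the set of such points.\<close>

lemma closure_points_same_tight:
  fixes x :: "real ^ 'n::finite"
  assumes "finite H" "rational_constraints H" "x \<in> solutions H"
  shows "closure {y \<in> points. y \<in> solutions H \<and> tight H y = tight H x} = cell H x" (is "closure ?S = _")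
proof
  show "closure ?S \<subseteq> cell H x"
    by (rule closure_minimal[OF _ closed_cell]) (auto simp: cell_def)
  show "cell H x \<subseteq> closure ?S"
  proof
    fix z assume z: "z \<in> cell H x"
    show "z \<in> closure ?S"
      unfolding closure_approachable
    proof (intro allI impI)
      fix e :: real assume e: "0 < e"
      define D where "D = 1 + dist x z"
      have D: "0 < D" "dist x z \<le> D" by (auto simp: D_def add_pos_nonneg)
      \<comment> \<open>Half of \<open>e\<close> is spent on the move from \<open>z\<close> to
        \<open>p\<close>, the other half on the approximation of \<open>p\<close>.\<close>
      define s where "s = min (1 / 2) (e / (2 * D))"
      have s: "0 < s" "s \<le> 1 / 2" "s \<le> e / (2 * D)"
        using e D(1) unfolding s_def by (simp_all only: min_less_iff_conj min.cobounded1 min.cobounded2) simp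
      define p where "p = (1 - s) *\<^sub>R z + s *\<^sub>R x"
      have "s * dist x z \<le> e / (2 * D) * D"
        using s D by (intro mult_mono) auto
      also have "\<dots> = e / 2"
        using D(1) by (simp add: field_simps)
      finally have "s * dist x z \<le> e / 2" .
      moreover have "dist p z = s * dist x z"
      proof -
        have "p - z = s *\<^sub>R (x - z)" by (simp add: p_def algebra_simps)
        then show ?thesis using s by (simp add: dist_norm)
      qed
      ultimately have pz: "dist p z \<le> e / 2" by simp
      have psol: "p \<in> solutions H"
        using z assms(3) s by (auto simp: p_def solutions_def constraint_value_combination mem_cell_iff)
      have "constraint_value c p = 0 \<longleftrightarrow> constraint_value c x = 0" if "c \<in> H" for c
      proof -
        have "0 \<le> constraint_value c z" "0 \<le> constraint_value c x"
          "constraint_value c x = 0 \<longrightarrow> constraint_value c z = 0"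
          using that z assms(3) by (auto simp: mem_cell_iff solutions_def)
        then show ?thesis
          using s by (auto simp: p_def constraint_value_combination add_nonneg_eq_0_iff)
      qed
      then have ptight: "tight H p = tight H x" by (auto simp: tight_def)
      obtain y where "y \<in> points" "y \<in> solutions H" "dist y p < e / 2" "tight H y = tight H p"
        using points_dense_in_relative_interior[OF assms(1,2) psol, of "e / 2"] e by auto
      moreover from this have "dist y z < e"
        using dist_triangle[of y z p] pz by linarith
      ultimately show "\<exists>y\<in>?S. dist y z < e" using ptight by auto
    qed
  qed
qed

lemma rational_polyhedron_cell:
  assumes "finite H" "rational_constraints H"
  shows "rational_polyhedron \<Gamma> (cell H x)"
proof -
  define R where "R = (\<lambda>c. (- fst c, snd c)) ` H \<union> (\<lambda>c. (fst c, - snd c)) ` tight H x"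
  have "finite R" using assms(1) by (simp add: R_def tight_def)
  then obtain n f where f: "R = f ` {i::nat. i < n}"
    unfolding finite_conv_nat_seg_image by blast
  have R: "(\<forall>j. fst c $ j \<in> \<rat>) \<and> snd c \<in> \<Gamma>" if "c \<in> R" for c
    using that assms(2) by (auto simp: R_def rational_constraints_def tight_def uminus_mem)
  have "cell H x = {y. \<forall>c\<in>R. fst c \<bullet> y \<le> snd c}"
  proof (intro equalityI subsetI CollectI ballI)
    fix y c assume "y \<in> cell H x" "c \<in> R"
    then show "fst c \<bullet> y \<le> snd c"
      by (auto simp: R_def cell_def solutions_def tight_def constraint_value_def)
  next
    fix y assume "y \<in> {y. \<forall>c\<in>R. fst c \<bullet> y \<le> snd c}"
    then have y: "\<And>c. c \<in> R \<Longrightarrow> fst c \<bullet> y \<le> snd c" by blast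
    have "0 \<le> constraint_value c y" if "c \<in> H" for c
      using y[of "(- fst c, snd c)"] that by (simp add: R_def constraint_value_def)
    moreover have "constraint_value c y \<le> 0" if "c \<in> tight H x" for c
      using y[of "(fst c, - snd c)"] that by (simp add: R_def constraint_value_def)
    ultimately show "y \<in> cell H x"
      by (force simp: mem_cell_iff tight_def intro: antisym)
  qed
  also have "\<dots> = {y. \<forall>i<n. (\<Sum>j\<in>UNIV. fst (f i) $ j * y $ j) \<le> snd (f i)}"
    by (auto simp: f inner_vec_def)
  finally show ?thesis
    unfolding rational_polyhedron_def using R f
    by (intro exI[of _ n] exI[of _ "\<lambda>i. fst (f i)"] exI[of _ "\<lambda>i. snd (f i)"]) auto
qed

text \<open>The system chosen for \<open>w\<close> describes the class of each of its solutions in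
  \<open>points\<close>, not only that of \<open>w\<close>. So its cell at any solution is the
  closure of a class: the base point can be replaced by one in \<open>points\<close> with the same
  tight constraints.\<close>

lemma polyhedral_complex_of_classes:
  fixes cls :: "real ^ 'n::finite \<Rightarrow> (real ^ 'n) set"
  assumes "finite \<H>" and H: "\<And>H. H \<in> \<H> \<Longrightarrow> finite H \<and> rational_constraints H"
    and cls: "\<And>w. w \<in> points \<Longrightarrow> \<exists>H\<in>\<H>. w \<in> solutions H \<and>
      (\<forall>x\<in>points \<inter> solutions H.
        cls x = {y \<in> points. y \<in> solutions H \<and> tight H y = tight H x})"
  defines "\<C> \<equiv> {closure (cls w) | w. w \<in> points}"
  shows "finite \<C>" "polyhedral_complex \<C>" "\<forall>P\<in>\<C>. rational_polyhedron \<Gamma> P"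
proof -
  have "\<exists>\<eta>. \<forall>w\<in>points. \<eta> w \<in> \<H> \<and> w \<in> solutions (\<eta> w) \<and>
      (\<forall>x\<in>points \<inter> solutions (\<eta> w).
        cls x = {y \<in> points. y \<in> solutions (\<eta> w) \<and> tight (\<eta> w) y = tight (\<eta> w) x})"
    by (rule bchoice) (use cls in blast)
  then obtain \<eta> where \<eta>: "\<And>w. w \<in> points \<Longrightarrow> \<eta> w \<in> \<H>" "\<And>w. w \<in> points \<Longrightarrow> w \<in> solutions (\<eta> w)"
    and cl: "\<And>w x. w \<in> points \<Longrightarrow> x \<in> points \<Longrightarrow> x \<in> solutions (\<eta> w) \<Longrightarrow>
      cls x = {y \<in> points. y \<in> solutions (\<eta> w) \<and> tight (\<eta> w) y = tight (\<eta> w) x}"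
    by blast
  have fin: "finite (\<eta> w)" "rational_constraints (\<eta> w)" if "w \<in> points" for w
    using H \<eta>(1) that by auto
  have closure_cls: "closure (cls x) = cell (\<eta> w) x"
    if "w \<in> points" "x \<in> points" "x \<in> solutions (\<eta> w)" for w x
    using cl[OF that] closure_points_same_tight[OF fin[OF that(1)] that(3)] by simp
  have \<C>_eq: "\<C> = {cell (\<eta> w) w | w. w \<in> points}"
    unfolding \<C>_def using closure_cls \<eta>(2) by blast
  have mem: "cell (\<eta> w) x \<in> \<C>" if w: "w \<in> points" "x \<in> solutions (\<eta> w)" for w x
  proof -
    obtain y where y: "y \<in> points" "y \<in> solutions (\<eta> w)" "tight (\<eta> w) y = tight (\<eta> w) x"
      using points_dense_in_relative_interior[OF fin[OF w(1)] w(2), of 1] by auto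
    then have "cell (\<eta> w) x = closure (cls y)"
      using closure_cls[OF w(1) y(1,2)] cell_cong[OF y(3)] by simp
    then show ?thesis using y(1) by (auto simp: \<C>_def)
  qed
  \<comment> \<open>A cell is determined by its system and a subset of that system; both have
    finitely many values.\<close>
  have "\<C> \<subseteq> (\<lambda>(H, S). {y \<in> solutions H. S \<subseteq> tight H y}) ` (SIGMA H:\<H>. Pow H)"
  proof
    fix P assume "P \<in> \<C>"
    then obtain w where w: "w \<in> points" "P = cell (\<eta> w) w" by (auto simp: \<C>_eq)
    then show "P \<in> (\<lambda>(H, S). {y \<in> solutions H. S \<subseteq> tight H y}) ` (SIGMA H:\<H>. Pow H)"
      using \<eta>(1) by (intro image_eqI[of _ _ "(\<eta> w, tight (\<eta> w) w)"]) (auto simp: cell_def tight_def)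
  qed
  then show "finite \<C>"
    using assms(1) H by (auto intro: finite_subset)
  show "\<forall>P\<in>\<C>. rational_polyhedron \<Gamma> P"
    using rational_polyhedron_cell fin by (auto simp: \<C>_eq)
  show "polyhedral_complex \<C>"
    unfolding polyhedral_complex_def
  proof (intro conjI ballI allI impI)
    show "polyhedron P" if "P \<in> \<C>" for P
      using that polyhedron_cell fin by (auto simp: \<C>_eq)
    show "F \<in> \<C>" if P: "P \<in> \<C>" and F: "F face_of P \<and> F \<noteq> {}" for P F
    proof -
      obtain w where w: "w \<in> points" "P = cell (\<eta> w) w" using P by (auto simp: \<C>_eq)
      have "convex F" using F face_of_imp_convex by blast
      then obtain p where p: "p \<in> rel_interior F"
        using F rel_interior_eq_empty by blast
      have "F = cell (\<eta> w) p"
        using face_of_cell_eq[OF fin(1)[OF w(1)] _ p] F w(2) by blast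
      moreover have "p \<in> solutions (\<eta> w)"
        using p F w(2) rel_interior_subset face_of_imp_subset unfolding cell_def by blast
      ultimately show ?thesis using mem[OF w(1)] by simp
    qed
    show "P \<inter> Q = {} \<or> P \<inter> Q face_of P \<and> P \<inter> Q face_of Q" if PQ: "P \<in> \<C>" "Q \<in> \<C>" for P Q
    proof (cases "P \<inter> Q = {}")
      case False
      obtain w where w: "w \<in> points" "P = cell (\<eta> w) w" using PQ(1) by (auto simp: \<C>_eq)
      obtain w' where w': "w' \<in> points" "Q = cell (\<eta> w') w'" using PQ(2) by (auto simp: \<C>_eq)
      have "convex (P \<inter> Q)" by (simp add: w(2) w'(2) convex_Int convex_cell)
      then obtain p where p: "p \<in> rel_interior (P \<inter> Q)"
        using False rel_interior_eq_empty by blast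
      have pPQ: "p \<in> P" "p \<in> Q" using p rel_interior_subset by blast+
      \<comment> \<open>A point \<open>y\<close> approximating \<open>p\<close> with respect to the
        union keeps the tight sets of \<open>p\<close> in both systems, so the class of
        \<open>y\<close> computes both cells at \<open>p\<close>.\<close>
      let ?H = "\<eta> w \<union> \<eta> w'"
      have H': "finite ?H" "rational_constraints ?H"
        using fin w(1) w'(1) by (auto simp: rational_constraints_def)
      have psol: "p \<in> solutions ?H"
        using pPQ w(2) w'(2) by (auto simp: solutions_Un cell_def)
      obtain y where y: "y \<in> points" "y \<in> solutions ?H" "tight ?H y = tight ?H p"
        using points_dense_in_relative_interior[OF H' psol, of 1] by auto
      have ty: "tight (\<eta> w) y = tight (\<eta> w) p" "tight (\<eta> w') y = tight (\<eta> w') p"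
        using y(3) by (auto simp: tight_def)
      have "cell (\<eta> w) p = closure (cls y)"
        using closure_cls[OF w(1) y(1)] y(2) cell_cong[OF ty(1)] by (simp add: solutions_Un)
      moreover have "cell (\<eta> w') p = closure (cls y)"
        using closure_cls[OF w'(1) y(1)] y(2) cell_cong[OF ty(2)] by (simp add: solutions_Un)
      ultimately have eq: "cell (\<eta> w) p = cell (\<eta> w') p" by simp
      have faces: "cell (\<eta> w) p face_of P" "cell (\<eta> w) p face_of Q"
        using cell_face_of pPQ w(2) w'(2) eq by metis+
      \<comment> \<open>The common cell is a face that meets the relative interior of the
        intersection, so it contains the whole intersection.\<close>
      have "P \<inter> Q \<subseteq> cell (\<eta> w) p"
        by (rule subset_of_face_of[OF faces(1)]) (use p psol self_mem_cell[of p "\<eta> w"] in \<open>auto simp: solutions_Un\<close>)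
      then have "P \<inter> Q = cell (\<eta> w) p"
        using faces face_of_imp_subset by blast
      then show ?thesis using faces by simp
    qed simp
  qed
qed

end

section \<open>Dickson's lemma and monomials\<close>

definition monomial_ideal :: "('n \<Rightarrow>\<^sub>0 nat) set \<Rightarrow> bool"
  where "monomial_ideal M \<longleftrightarrow> (\<forall>u\<in>M. \<forall>a. a + u \<in> M)"

text \<open>A decreasing subsequence of naturals attains its least value and is constant from there
  on, so its tail is nondecreasing as well.\<close>

lemma nat_seq_mono_subseq:
  fixes X :: "nat \<Rightarrow> nat"
  obtains f where "strict_mono f" "incseq (X \<circ> f)"
proof -
  obtain f where f: "strict_mono f" "monoseq (\<lambda>n. X (f n))"
    using seq_monosub[of X] by blast
  show thesis
  proof (cases "incseq (\<lambda>n. X (f n))")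
    case True
    with f(1) that[of f] show thesis by (simp add: comp_def)
  next
    case False
    then have dec: "decseq (\<lambda>n. X (f n))"
      using f(2) by (simp add: monoseq_iff)
    define m where "m = (LEAST m. m \<in> range (\<lambda>n. X (f n)))"
    have "m \<in> range (\<lambda>n. X (f n))"
      unfolding m_def by (rule LeastI[of _ "X (f 0)"]) simp
    then obtain N where N: "X (f N) = m" by auto
    have min: "m \<le> X (f n)" for n
      unfolding m_def by (rule Least_le) simp
    have const: "X (f (n + N)) = m" for n
      using decseqD[OF dec, of N "n + N"] N min[of "n + N"] by simp
    have "strict_mono (\<lambda>n. f (n + N))"
      using f(1) by (simp add: strict_mono_def)
    moreover have "incseq (X \<circ> (\<lambda>n. f (n + N)))"
      by (simp add: comp_def const)
    ultimately show thesis by (rule that)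
  qed
qed

lemma monomial_dvd_iff:
  fixes u v :: "'n \<Rightarrow>\<^sub>0 nat"
  shows "(\<exists>a. v = a + u) \<longleftrightarrow> (\<forall>i. Poly_Mapping.lookup u i \<le> Poly_Mapping.lookup v i)"
proof
  assume le: "\<forall>i. Poly_Mapping.lookup u i \<le> Poly_Mapping.lookup v i"
  have "v = (v - u) + u"
    by (rule poly_mapping_eqI) (simp add: lookup_add lookup_minus le)
  then show "\<exists>a. v = a + u" by blast
qed (auto simp: lookup_add)

text \<open>Passing to a subsequence once per coordinate makes all coordinates nondecreasing; the
  first two members are then comparable.\<close>

theorem Dickson:
  fixes s :: "nat \<Rightarrow> ('n::finite \<Rightarrow>\<^sub>0 nat)"
  obtains i j a where "i < j" "s j = a + s i"
proof -
  have "\<exists>r. strict_mono r \<and> (\<forall>x\<in>A. incseq (\<lambda>k. Poly_Mapping.lookup (s (r k)) x))" for A :: "'n set"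
  proof (induct A rule: infinite_finite_induct)
    case (insert x A)
    then obtain r where r: "strict_mono r" "\<And>y. y \<in> A \<Longrightarrow> incseq (\<lambda>k. Poly_Mapping.lookup (s (r k)) y)"
      by blast
    obtain f where f: "strict_mono f" "incseq ((\<lambda>k. Poly_Mapping.lookup (s (r k)) x) \<circ> f)"
      by (rule nat_seq_mono_subseq)
    have "incseq (\<lambda>k. Poly_Mapping.lookup (s ((r \<circ> f) k)) y)" if "y \<in> insert x A" for y
    proof (cases "y = x")
      case False
      then show ?thesis
        using r(2)[of y] that f(1) by (simp add: incseq_def strict_mono_less_eq)
    qed (use f(2) in \<open>simp add: comp_def\<close>)
    then show ?case using strict_mono_o[OF r(1) f(1)] by blast
  qed (auto intro: exI[of _ id] simp: strict_mono_def)
  then obtain r where r: "strict_mono r" "\<And>x. incseq (\<lambda>k. Poly_Mapping.lookup (s (r k)) x)"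
    by blast
  have "r 0 < r 1" using r(1) by (simp add: strict_mono_def)
  moreover have "\<forall>x. Poly_Mapping.lookup (s (r 0)) x \<le> Poly_Mapping.lookup (s (r 1)) x"
    using r(2) by (simp add: incseq_def)
  ultimately show thesis
    using that monomial_dvd_iff[of "s (r 1)" "s (r 0)"] by blast
qed

text \<open>Otherwise every finite subset fails to generate some element of \<open>M\<close>;
  adjoining such elements one at a time gives a sequence that contradicts
  \<open>Dickson\<close>.\<close>

lemma monomial_ideal_finitely_generated:
  fixes M :: "('n::finite \<Rightarrow>\<^sub>0 nat) set"
  assumes "monomial_ideal M"
  obtains G where "finite G" "G \<subseteq> M" "\<And>u. u \<in> M \<Longrightarrow> \<exists>g\<in>G. \<exists>a. u = a + g"
proof (rule ccontr)
  assume contra: "\<not> thesis"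
  note generators = that
  have "\<exists>u\<in>M. \<forall>g\<in>G. \<nexists>a. u = a + g" if "finite G" "G \<subseteq> M" for G
    using contra generators[of G] that by blast
  then obtain next_elt where nxt: "\<And>G. finite G \<Longrightarrow> G \<subseteq> M \<Longrightarrow>
      next_elt G \<in> M \<and> (\<forall>g\<in>G. \<nexists>a. next_elt G = a + g)"
    by metis
  define chain where "chain = rec_nat {} (\<lambda>_ G. insert (next_elt G) G)"
  have chain_simps: "chain 0 = {}" "\<And>k. chain (Suc k) = insert (next_elt (chain k)) (chain k)"
    by (simp_all add: chain_def)
  have chain: "finite (chain k) \<and> chain k \<subseteq> M" for k
    by (induct k) (auto simp: chain_simps dest: nxt)
  have "mono chain"
    by (auto simp: mono_iff_le_Suc chain_simps)
  obtain i j a where ij: "i < j" "next_elt (chain j) = a + next_elt (chain i)"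
    by (rule Dickson[of "\<lambda>k. next_elt (chain k)"])
  have "next_elt (chain i) \<in> chain (Suc i)" by (simp add: chain_simps)
  also have "chain (Suc i) \<subseteq> chain j"
    using \<open>mono chain\<close> ij(1) by (simp add: monoD Suc_leI)
  finally show False using nxt[of "chain j"] chain[of j] ij(2) by blast
qed

text \<open>The ascending chain condition, oriented for the induction in
  \<open>finite_lead_sets\<close>, which descends by enlarging an ideal.\<close>

lemma wf_monomial_ideals:
  "wf {(J', J :: ('n::finite \<Rightarrow>\<^sub>0 nat) set). monomial_ideal J \<and> J \<subset> J'}"
  unfolding wf_iff_no_infinite_down_chain
proof
  assume "\<exists>f. \<forall>i. (f (Suc i), f i) \<in> {(J', J :: ('n \<Rightarrow>\<^sub>0 nat) set). monomial_ideal J \<and> J \<subset> J'}"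
  then obtain f :: "nat \<Rightarrow> ('n \<Rightarrow>\<^sub>0 nat) set"
    where chain: "\<forall>i. (f (Suc i), f i) \<in> {(J', J). monomial_ideal J \<and> J \<subset> J'}" ..
  then have f: "monomial_ideal (f i)" "f i \<subset> f (Suc i)" for i by simp_all
  have "\<forall>i. \<exists>u. u \<in> f (Suc i) \<and> u \<notin> f i" using f(2) by blast
  then obtain s where s: "\<And>i. s i \<in> f (Suc i)" "\<And>i. s i \<notin> f i" by metis
  have "mono f" using f(2) by (auto simp: mono_iff_le_Suc)
  obtain i j a where ij: "i < j" "s j = a + s i" by (rule Dickson)
  have "f (Suc i) \<subseteq> f j" using \<open>mono f\<close> ij(1) by (simp add: monoD Suc_leI)
  then have "s j \<in> f j" using s(1)[of i] f(1)[of j] ij(2) by (auto simp: monomial_ideal_def)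
  then show False using s(2) by blast
qed

text \<open>A multiplicative injection into the natural numbers, hence a term order; it breaks ties
  between terms of equal weight.\<close>

definition mono_rank :: "('n::finite \<Rightarrow>\<^sub>0 nat) \<Rightarrow> nat"
  where "mono_rank u = (\<Prod>i\<in>UNIV. enumerate {p. prime p} (to_nat i) ^ Poly_Mapping.lookup u i)"

lemma prime_enumerate: "prime (enumerate {p::nat. prime p} k)"
  using enumerate_in_set[OF primes_infinite] by auto

lemma mono_rank_add: "mono_rank (u + v) = mono_rank u * mono_rank v"
  by (simp add: mono_rank_def lookup_add power_add prod.distrib)

lemma mono_rank_pos: "0 < mono_rank u"
  unfolding mono_rank_def using prime_enumerate by (simp add: prime_gt_0_nat prod_pos)

text \<open>Unique factorization: the multiplicity of a prime recovers the exponent of its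
  variable.\<close>

lemma mono_rank_inj: "inj mono_rank"
proof (rule injI, rule poly_mapping_eqI)
  fix u v :: "'n::finite \<Rightarrow>\<^sub>0 nat" and i :: 'n
  assume eq: "mono_rank u = mono_rank v"
  define p where "p j = enumerate {p::nat. prime p} (to_nat j)" for j :: 'n
  have "inj (enumerate {p::nat. prime p})"
    using strict_mono_enumerate[OF primes_infinite] by (rule strict_mono_imp_inj_on)
  then have p: "inj p" unfolding p_def inj_def by (metis to_nat_split)
  have "multiplicity (p i) (mono_rank w) = Poly_Mapping.lookup w i" for w :: "'n \<Rightarrow>\<^sub>0 nat"
  proof -
    have "mono_rank w = (\<Prod>q\<in>range p. q ^ Poly_Mapping.lookup w (inv p q))"
      using p by (subst prod.reindex) (auto simp: mono_rank_def p_def[symmetric])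
    moreover have "prime (p j)" for j by (simp add: p_def prime_enumerate)
    then have "multiplicity (p i) (\<Prod>q\<in>range p. q ^ Poly_Mapping.lookup w (inv p q)) =
        Poly_Mapping.lookup w i"
      using p by (subst multiplicity_prod_prime_powers) auto
    ultimately show ?thesis by simp
  qed
  then show "Poly_Mapping.lookup u i = Poly_Mapping.lookup v i" using eq by metis
qed

section \<open>Monomial multiples and homogeneous components\<close>

lemma sum_single_lookup: "(\<Sum>v\<in>Poly_Mapping.keys f. Poly_Mapping.single v (Poly_Mapping.lookup f v)) = f"
  by (rule poly_mapping_eqI)
    (simp add: lookup_sum lookup_single when_def sum.delta in_keys_iff)

lemma lookup_single_times:
  fixes f :: "'b::cancel_comm_monoid_add \<Rightarrow>\<^sub>0 'c::semiring_0"
  shows "Poly_Mapping.lookup (Poly_Mapping.single a c * f) (a + v) = c * Poly_Mapping.lookup f v"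
proof -
  have "Poly_Mapping.single a c * f =
      Poly_Mapping.single a c * (\<Sum>v\<in>Poly_Mapping.keys f. Poly_Mapping.single v (Poly_Mapping.lookup f v))"
    by (simp only: sum_single_lookup)
  also have "\<dots> = (\<Sum>v\<in>Poly_Mapping.keys f. Poly_Mapping.single (a + v) (c * Poly_Mapping.lookup f v))"
    by (simp add: sum_distrib_left mult_single)
  finally show ?thesis
    by (simp add: lookup_sum lookup_single when_def sum.delta in_keys_iff)
qed

lemma keys_single_times_subset:
  fixes f :: "'b::cancel_comm_monoid_add \<Rightarrow>\<^sub>0 'c::semiring_0"
  shows "Poly_Mapping.keys (Poly_Mapping.single a c * f) \<subseteq> (+) a ` Poly_Mapping.keys f"
  using keys_mult[of "Poly_Mapping.single a c" f] by (auto split: if_splits)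

lemma keys_single_times:
  fixes f :: "'b::cancel_comm_monoid_add \<Rightarrow>\<^sub>0 'c::field"
  assumes "c \<noteq> 0"
  shows "Poly_Mapping.keys (Poly_Mapping.single a c * f) = (+) a ` Poly_Mapping.keys f"
  using keys_single_times_subset[of a c f] assms
  by (auto simp: in_keys_iff lookup_single_times)

lemma lookup_scalar_times:
  fixes f :: "'b::cancel_comm_monoid_add \<Rightarrow>\<^sub>0 'c::semiring_0"
  shows "Poly_Mapping.lookup (Poly_Mapping.single 0 c * f) v = c * Poly_Mapping.lookup f v"
  using lookup_single_times[of 0 c f v] by simp

text \<open>A multiplier is a sum of monomials, and monomial multiples merely shift degrees and
  initial forms.\<close>

lemma ideal_span_monomial_induct [consumes 1, case_names zero add monomial]:
  fixes H :: "('b::cancel_comm_monoid_add \<Rightarrow>\<^sub>0 'c::comm_ring_1) set"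
  assumes "x \<in> ideal.span H"
    and zero: "P 0" and add: "\<And>x y. P x \<Longrightarrow> P y \<Longrightarrow> P (x + y)"
    and monomial: "\<And>a c h. h \<in> H \<Longrightarrow> P (Poly_Mapping.single a c * h)"
  shows "P x"
  using assms(1)
proof (induct rule: ideal.span_induct_alt)
  case base
  show ?case by (rule zero)
next
  case (step q h y)
  have "P (\<Sum>v\<in>A. Poly_Mapping.single v (Poly_Mapping.lookup q v) * h)" for A
    by (induct A rule: infinite_finite_induct) (auto intro: zero add monomial step(1))
  then have "P ((\<Sum>v\<in>Poly_Mapping.keys q. Poly_Mapping.single v (Poly_Mapping.lookup q v)) * h)"
    by (simp add: sum_distrib_right)
  then show ?case
    using step(2) by (simp add: sum_single_lookup add)
qed

definition total_degree :: "('n::finite \<Rightarrow>\<^sub>0 nat) \<Rightarrow> nat"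
  where "total_degree u = (\<Sum>i\<in>UNIV. Poly_Mapping.lookup u i)"

lemma total_degree_add: "total_degree (u + v) = total_degree u + total_degree v"
  by (simp add: total_degree_def lookup_add sum.distrib)

lemma finite_total_degree: "finite {u :: 'n::finite \<Rightarrow>\<^sub>0 nat. total_degree u = d}"
proof (rule finite_subset)
  show "{u :: 'n \<Rightarrow>\<^sub>0 nat. total_degree u = d} \<subseteq> Poly_Mapping.lookup -` (UNIV \<rightarrow>\<^sub>E {..d})"
    by (auto simp: total_degree_def intro!: member_le_sum)
  show "finite (Poly_Mapping.lookup -` ((UNIV :: 'n set) \<rightarrow>\<^sub>E {..d}))"
    by (rule finite_vimageI) (auto intro!: finite_PiE simp: inj_on_def)
qed

definition component :: "nat \<Rightarrow> ('n::finite, 'a::zero) mpoly \<Rightarrow> ('n, 'a) mpoly"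
  where "component d f = Poly_Mapping.mapp (\<lambda>u c. c when total_degree u = d) f"

lemma lookup_component:
  "Poly_Mapping.lookup (component d f) u = (Poly_Mapping.lookup f u when total_degree u = d)"
  by (simp add: component_def lookup_mapp when_def in_keys_iff)

text \<open>A monomial multiple of a homogeneous generator is homogeneous, so its component is all
  of it or 0.\<close>

lemma component_mem_homogeneous_ideal:
  fixes I :: "('n::finite, 'a::field) mpoly set"
  assumes "homogeneous_ideal I" "f \<in> I"
  shows "component d f \<in> I"
proof -
  obtain H where H: "\<And>h. h \<in> H \<Longrightarrow> homogeneous h" and I: "I = ideal.span H"
    using assms(1) by (auto simp: homogeneous_ideal_def)
  from assms(2)[unfolded I] show ?thesis
  proof (induct rule: ideal_span_monomial_induct)
    case zero
    have "component d 0 = (0 :: ('n, 'a) mpoly)"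
      by (rule poly_mapping_eqI) (simp add: lookup_component)
    then show ?case by (simp add: I ideal.span_zero)
  next
    case (add x y)
    have "component d (x + y) = component d x + component d y"
      by (rule poly_mapping_eqI) (simp add: lookup_component lookup_add when_def)
    then show ?case using add by (simp add: I ideal.span_add)
  next
    case (monomial a c h)
    obtain e where e: "\<And>u. u \<in> Poly_Mapping.keys h \<Longrightarrow> total_degree u = e"
      using H[OF monomial] by (auto simp: homogeneous_def total_degree_def)
    let ?g = "Poly_Mapping.single a c * h"
    have deg: "total_degree u = total_degree a + e" if "u \<in> Poly_Mapping.keys ?g" for u
      using that keys_single_times_subset[of a c h] e by (auto simp: total_degree_add)
    have "component d ?g = (if d = total_degree a + e then ?g else 0)"
      using deg by (intro poly_mapping_eqI) (auto simp: lookup_component when_def in_keys_iff)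
    then show ?case
      using monomial by (simp add: I ideal.span_zero ideal.span_scale ideal.span_base)
  qed
qed

section \<open>Leading exponents and reduced polynomials\<close>

text \<open>The upper bound is the ultrametric inequality for
  \<open>a = (a + b) + (- b)\<close>.\<close>

lemma val_add_dominant:
  fixes a b :: "'a::valued_field"
  assumes "a \<noteq> 0" "b \<noteq> 0 \<Longrightarrow> val a < val b"
  shows "a + b \<noteq> 0" "val (a + b) = val a"
proof -
  show nz: "a + b \<noteq> 0"
  proof
    assume "a + b = 0"
    then have "b = - a" by (simp add: eq_neg_iff_add_eq_0 add.commute)
    then show False using assms by simp
  qed
  show "val (a + b) = val a"
  proof (cases "b = 0")
    case False
    have "val a \<le> val (a + b)"
      using val_add[of a b] nz False assms by simp
    moreover have "min (val (a + b)) (val b) \<le> val a"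
      using val_add[of "a + b" "- b"] nz False assms(1) by simp
    ultimately show ?thesis using assms(2)[OF False] by linarith
  qed simp
qed

definition weight :: "real ^ 'n::finite \<Rightarrow> ('n \<Rightarrow>\<^sub>0 nat) \<Rightarrow> real"
  where "weight w u = (\<Sum>i\<in>UNIV. w $ i * real (Poly_Mapping.lookup u i))"

lemma weight_add: "weight w (u + v) = weight w u + weight w v"
  by (simp add: weight_def lookup_add algebra_simps sum.distrib)

lemma weight_zero [simp]: "weight w 0 = 0"
  by (simp add: weight_def)

lemma term_weight_eq: "term_weight w f u = val (Poly_Mapping.lookup f u) + weight w u"
  by (simp add: term_weight_def weight_def)

lemma term_weight_single_times:
  assumes "c \<noteq> 0" "v \<in> Poly_Mapping.keys f"
  shows "term_weight w (Poly_Mapping.single a c * f) (a + v) = val c + weight w a + term_weight w f v"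
  using assms by (simp add: term_weight_eq lookup_single_times weight_add val_mult in_keys_iff)

definition precedes :: "real \<times> nat \<Rightarrow> real \<times> nat \<Rightarrow> bool"
  where "precedes p q \<longleftrightarrow> fst p < fst q \<or> fst p = fst q \<and> snd p < snd q"

definition sort_key :: "real ^ 'n::finite \<Rightarrow> ('n, 'a::valued_field) mpoly \<Rightarrow> ('n \<Rightarrow>\<^sub>0 nat) \<Rightarrow> real \<times> nat"
  where "sort_key w f u = (term_weight w f u, mono_rank u)"

text \<open>Leading means minimal, in keeping with the minimum in \<open>trop\<close>; the smaller
  rank wins among equal weights, so at most one exponent leads.\<close>

definition leads :: "real ^ 'n::finite \<Rightarrow> ('n, 'a::valued_field) mpoly \<Rightarrow> ('n \<Rightarrow>\<^sub>0 nat) \<Rightarrow> bool"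
  where "leads w f u \<longleftrightarrow> u \<in> Poly_Mapping.keys f \<and>
    (\<forall>v\<in>Poly_Mapping.keys f. v \<noteq> u \<longrightarrow> precedes (sort_key w f u) (sort_key w f v))"

text \<open>With \<open>p\<close> the key of a leading term, these are polynomials that can be added
  without disturbing that term.\<close>

definition behind :: "real ^ 'n::finite \<Rightarrow> real \<times> nat \<Rightarrow> ('n, 'a::valued_field) mpoly \<Rightarrow> bool"
  where "behind w p f \<longleftrightarrow> (\<forall>v\<in>Poly_Mapping.keys f. precedes p (sort_key w f v))"

lemma precedes_trans: "precedes p q \<Longrightarrow> precedes q r \<Longrightarrow> precedes p r"
  by (auto simp: precedes_def)

lemma leads_term_weight_le:
  "leads w f u \<Longrightarrow> v \<in> Poly_Mapping.keys f \<Longrightarrow> term_weight w f u \<le> term_weight w f v"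
  by (cases "v = u") (auto simp: leads_def precedes_def sort_key_def)

lemma ex_leads:
  assumes "f \<noteq> 0"
  obtains u where "leads w f u"
proof -
  let ?W = "Min (term_weight w f ` Poly_Mapping.keys f)"
  let ?A = "{u \<in> Poly_Mapping.keys f. term_weight w f u = ?W}"
  have ne: "Poly_Mapping.keys f \<noteq> {}" using assms by simp
  then have "?W \<in> term_weight w f ` Poly_Mapping.keys f" by (intro Min_in) auto
  then have "?A \<noteq> {}" by auto
  then have "Min (mono_rank ` ?A) \<in> mono_rank ` ?A" by (intro Min_in) auto
  then obtain u where u: "u \<in> ?A" "mono_rank u = Min (mono_rank ` ?A)" by auto
  have "precedes (sort_key w f u) (sort_key w f v)" if v: "v \<in> Poly_Mapping.keys f" "v \<noteq> u" for v
  proof (cases "term_weight w f v = ?W")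
    case True
    then have "mono_rank u \<le> mono_rank v" using u(2) v(1) by (auto intro: Min_le)
    moreover have "mono_rank u \<noteq> mono_rank v" using v(2) mono_rank_inj by (auto dest: injD)
    ultimately show ?thesis using True u(1) by (simp add: precedes_def sort_key_def)
  next
    case False
    moreover have "?W \<le> term_weight w f v" using v(1) by simp
    ultimately show ?thesis using u(1) by (simp add: precedes_def sort_key_def)
  qed
  then show thesis using u(1) that by (auto simp: leads_def)
qed

lemma precedes_sort_key_add:
  assumes "v \<in> Poly_Mapping.keys f \<Longrightarrow> precedes p (sort_key w f v)"
    and "v \<in> Poly_Mapping.keys g \<Longrightarrow> precedes p (sort_key w g v)"
    and "v \<in> Poly_Mapping.keys (f + g)"
  shows "precedes p (sort_key w (f + g) v)"
proof (cases "v \<in> Poly_Mapping.keys f \<and> v \<in> Poly_Mapping.keys g")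
  case True
  then have "min (val (Poly_Mapping.lookup f v)) (val (Poly_Mapping.lookup g v)) \<le>
      val (Poly_Mapping.lookup f v + Poly_Mapping.lookup g v)"
    using assms(3) by (intro val_add) (auto simp: in_keys_iff lookup_add)
  then have "term_weight w f v \<le> term_weight w (f + g) v \<or> term_weight w g v \<le> term_weight w (f + g) v"
    by (auto simp: term_weight_eq lookup_add min_le_iff_disj)
  then show ?thesis
    using assms(1,2) True by (auto simp: precedes_def sort_key_def)
next
  case False
  then consider "Poly_Mapping.lookup f v = 0" "v \<in> Poly_Mapping.keys g"
    | "Poly_Mapping.lookup g v = 0" "v \<in> Poly_Mapping.keys f"
    using assms(3) by (auto simp: in_keys_iff lookup_add)
  then show ?thesis
    using assms(1,2) by cases (auto simp: sort_key_def term_weight_eq lookup_add)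
qed

lemma behind_zero: "behind w p 0"
  by (simp add: behind_def)

lemma behind_add: "behind w p f \<Longrightarrow> behind w p g \<Longrightarrow> behind w p (f + g)"
  by (auto simp: behind_def intro: precedes_sort_key_add)

lemma behind_sum: "(\<And>x. x \<in> A \<Longrightarrow> behind w p (f x)) \<Longrightarrow> behind w p (sum f A)"
  by (induct A rule: infinite_finite_induct) (auto intro: behind_zero behind_add)

text \<open>If \<open>g\<close> has a term at \<open>u\<close>, the ranks agree, so its valuation
  there is strictly larger and the sum keeps the valuation of \<open>f\<close>.\<close>

lemma leads_add:
  assumes "leads w f u" "behind w (sort_key w f u) g"
  shows "leads w (f + g) u"
proof -
  have "val (Poly_Mapping.lookup f u) < val (Poly_Mapping.lookup g u)" if "Poly_Mapping.lookup g u \<noteq> 0"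
  proof -
    have "u \<in> Poly_Mapping.keys g" using that by (simp add: in_keys_iff)
    then have "precedes (sort_key w f u) (sort_key w g u)"
      using assms(2) by (simp add: behind_def)
    then show ?thesis by (auto simp: precedes_def sort_key_def term_weight_eq)
  qed
  then have u: "u \<in> Poly_Mapping.keys (f + g)" "sort_key w (f + g) u = sort_key w f u"
    using val_add_dominant[of "Poly_Mapping.lookup f u" "Poly_Mapping.lookup g u"] assms(1)
    by (auto simp: leads_def in_keys_iff sort_key_def term_weight_eq lookup_add)
  show ?thesis
    unfolding leads_def u(2)
  proof (intro conjI ballI impI u(1))
    fix v assume "v \<in> Poly_Mapping.keys (f + g)" "v \<noteq> u"
    with assms show "precedes (sort_key w f u) (sort_key w (f + g) v)"
      by (intro precedes_sort_key_add) (auto simp: leads_def behind_def)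
  qed
qed

text \<open>All weights shift by the same amount, and \<open>mono_rank\<close> is multiplicative and
  positive, so ties are decided as before.\<close>

lemma leads_single_times:
  assumes "leads w f u" "c \<noteq> 0"
  shows "leads w (Poly_Mapping.single a c * f) (a + u)"
  unfolding leads_def
proof (intro conjI ballI impI)
  show "a + u \<in> Poly_Mapping.keys (Poly_Mapping.single a c * f)"
    using assms by (simp add: leads_def keys_single_times)
  fix v' assume v': "v' \<in> Poly_Mapping.keys (Poly_Mapping.single a c * f)" "v' \<noteq> a + u"
  then obtain v where v: "v \<in> Poly_Mapping.keys f" "v' = a + v"
    using assms(2) by (auto simp: keys_single_times)
  then have "precedes (sort_key w f u) (sort_key w f v)" "u \<in> Poly_Mapping.keys f"
    using assms(1) v'(2) by (auto simp: leads_def)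
  then show "precedes (sort_key w (Poly_Mapping.single a c * f) (a + u))
      (sort_key w (Poly_Mapping.single a c * f) v')"
    using assms(2) v mono_rank_pos[of a]
    by (simp add: precedes_def sort_key_def term_weight_single_times mono_rank_add)
qed

lemma leads_scalar_times:
  "leads w f u \<Longrightarrow> c \<noteq> 0 \<Longrightarrow> leads w (Poly_Mapping.single 0 c * f) u"
  using leads_single_times[of w f u c 0] by simp

text \<open>As \<open>g\<close> is monic at \<open>u\<close>, its multiple has at \<open>u\<close>
  the weight of the term of \<open>f\<close> that it cancels. That term comes after
  \<open>v\<close>, and the remaining terms of the multiple come later still.\<close>

lemma behind_cancel_term:
  assumes f: "leads w f v" and g: "leads w g u" "Poly_Mapping.lookup g u = 1" and "u \<noteq> v"
  shows "behind w (sort_key w f v) (Poly_Mapping.single 0 (- Poly_Mapping.lookup f u) * g)"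
proof (cases "Poly_Mapping.lookup f u = 0")
  case False
  let ?c = "- Poly_Mapping.lookup f u"
  have lead: "leads w (Poly_Mapping.single 0 ?c * g) u"
    using g(1) False by (intro leads_scalar_times) auto
  have "sort_key w (Poly_Mapping.single 0 ?c * g) u = sort_key w f u"
    using g(2) by (simp add: sort_key_def term_weight_eq lookup_scalar_times)
  moreover have "precedes (sort_key w f v) (sort_key w f u)"
    using f False assms(4) by (auto simp: leads_def in_keys_iff)
  ultimately have first: "precedes (sort_key w f v) (sort_key w (Poly_Mapping.single 0 ?c * g) u)"
    by simp
  show ?thesis
    unfolding behind_def
  proof
    fix v' assume "v' \<in> Poly_Mapping.keys (Poly_Mapping.single 0 ?c * g)"
    then have "v' = u \<or> precedes (sort_key w (Poly_Mapping.single 0 ?c * g) u)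
        (sort_key w (Poly_Mapping.single 0 ?c * g) v')"
      using lead by (auto simp: leads_def)
    then show "precedes (sort_key w f v) (sort_key w (Poly_Mapping.single 0 ?c * g) v')"
      using first precedes_trans by blast
  qed
qed (simp add: behind_zero)

section \<open>Leading exponent sets of a homogeneous ideal\<close>

locale graded_ideal =
  fixes I :: "('n::finite, 'a::valued_field) mpoly set"
  assumes homogeneous_ideal: "homogeneous_ideal I"
begin

lemma subspace: "ideal.subspace I"
  using homogeneous_ideal unfolding homogeneous_ideal_def by (metis ideal.subspace_span)

lemma add_mem: "f \<in> I \<Longrightarrow> g \<in> I \<Longrightarrow> f + g \<in> I"
  by (rule ideal.subspace_add[OF subspace])

lemma times_mem: "f \<in> I \<Longrightarrow> q * f \<in> I"
  by (rule ideal.subspace_scale[OF subspace])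

lemma sum_mem: "(\<And>x. x \<in> A \<Longrightarrow> f x \<in> I) \<Longrightarrow> sum f A \<in> I"
  by (rule ideal.subspace_sum[OF subspace])

lemma component_mem: "f \<in> I \<Longrightarrow> component d f \<in> I"
  by (rule component_mem_homogeneous_ideal[OF homogeneous_ideal])

definition lead_set :: "real ^ 'n \<Rightarrow> ('n \<Rightarrow>\<^sub>0 nat) set"
  where "lead_set w = {u. \<exists>f\<in>I. leads w f u}"

definition reduced :: "('n \<Rightarrow>\<^sub>0 nat) set \<Rightarrow> ('n \<Rightarrow>\<^sub>0 nat) \<Rightarrow> ('n, 'a) mpoly \<Rightarrow> bool"
  where "reduced M u f \<longleftrightarrow>
    f \<in> I \<and> Poly_Mapping.lookup f u = 1 \<and> Poly_Mapping.keys f \<inter> M = {u}"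

lemma monomial_ideal_lead_set: "monomial_ideal (lead_set w)"
  unfolding monomial_ideal_def lead_set_def
proof safe
  fix u f a assume "f \<in> I" "leads w f u"
  then have "Poly_Mapping.single a 1 * f \<in> I" "leads w (Poly_Mapping.single a 1 * f) (a + u)"
    by (auto intro: times_mem leads_single_times)
  then show "\<exists>f\<in>I. leads w f (a + u)" by blast
qed

text \<open>The leading exponent of a nonzero element would be in the lead set. Uniqueness arguments
  over the field rest on this: monomials outside of the lead set are independent modulo
  \<open>I\<close>.\<close>

lemma eq_0_if_outside_lead_set:
  assumes "f \<in> I" "Poly_Mapping.keys f \<inter> lead_set w = {}"
  shows "f = 0"
proof (rule ccontr)
  assume "f \<noteq> 0"
  then obtain u where "leads w f u" by (rule ex_leads)
  then have "u \<in> Poly_Mapping.keys f \<inter> lead_set w"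
    using assms(1) by (auto simp: lead_set_def leads_def)
  then show False using assms(2) by blast
qed

definition monic_leads :: "real ^ 'n \<Rightarrow> nat \<Rightarrow> ('n \<Rightarrow>\<^sub>0 nat) \<Rightarrow> ('n, 'a) mpoly \<Rightarrow> bool"
  where "monic_leads w d u f \<longleftrightarrow> f \<in> I \<and> (\<forall>v\<in>Poly_Mapping.keys f. total_degree v = d) \<and>
    leads w f u \<and> Poly_Mapping.lookup f u = 1"

lemma monic_leadsI:
  assumes "f \<in> I" "\<And>v. v \<in> Poly_Mapping.keys f \<Longrightarrow> total_degree v = d" "leads w f u"
  shows "monic_leads w d u (Poly_Mapping.single 0 (inverse (Poly_Mapping.lookup f u)) * f)"
proof -
  have nz: "Poly_Mapping.lookup f u \<noteq> 0" using assms(3) by (simp add: leads_def in_keys_iff)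
  then show ?thesis
    using assms by (auto simp: monic_leads_def times_mem leads_scalar_times lookup_scalar_times
        keys_single_times)
qed

text \<open>Restriction to the degree of \<open>u\<close> keeps the coefficient at \<open>u\<close>
  and only discards competitors.\<close>

lemma ex_monic_leads:
  assumes "u \<in> lead_set w"
  shows "\<exists>f. monic_leads w (total_degree u) u f"
proof -
  obtain f where f: "f \<in> I" "leads w f u" using assms by (auto simp: lead_set_def)
  let ?g = "component (total_degree u) f"
  have "leads w ?g u"
    using f(2) by (auto simp: leads_def in_keys_iff lookup_component when_def sort_key_def
        term_weight_eq split: if_splits)
  then have "monic_leads w (total_degree u) u
      (Poly_Mapping.single 0 (inverse (Poly_Mapping.lookup ?g u)) * ?g)"
    using f(1) by (intro monic_leadsI component_mem)
      (auto simp: in_keys_iff lookup_component when_def split: if_splits)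
  then show ?thesis by blast
qed

text \<open>Gaussian elimination: subtracting a multiple of a polynomial with another leading exponent
  in order to cancel a term does not disturb the leading term.\<close>

lemma reduced_family:
  assumes "finite T" "\<And>u. u \<in> T \<Longrightarrow> u \<in> lead_set w \<and> total_degree u = d"
  shows "\<exists>g. \<forall>u\<in>T. monic_leads w d u (g u) \<and>
    (\<forall>v\<in>T. v \<noteq> u \<longrightarrow> Poly_Mapping.lookup (g u) v = 0)"
  using assms
proof (induct T)
  case (insert x T)
  then obtain g where g: "\<And>u. u \<in> T \<Longrightarrow> monic_leads w d u (g u)"
    and g0: "\<And>u v. u \<in> T \<Longrightarrow> v \<in> T \<Longrightarrow> v \<noteq> u \<Longrightarrow> Poly_Mapping.lookup (g u) v = 0"
    by blast
  have g1: "Poly_Mapping.lookup (g u) u = 1" if "u \<in> T" for u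
    using g[OF that] by (simp add: monic_leads_def)
  obtain f where f: "monic_leads w d x f"
    using ex_monic_leads[of x w] insert.prems[of x] by auto
  \<comment> \<open>Adding \<open>h\<close> clears the exponents in \<open>T\<close> from
    \<open>f\<close>; no \<open>g u\<close> contains another exponent of \<open>T\<close>, so each
    summand clears its own one only.\<close>
  define h where "h = (\<Sum>u\<in>T. Poly_Mapping.single 0 (- Poly_Mapping.lookup f u) * g u)"
  have hI: "h \<in> I"
    unfolding h_def using g by (intro sum_mem times_mem) (simp add: monic_leads_def)
  have "behind w (sort_key w f x) h"
    unfolding h_def
  proof (intro behind_sum behind_cancel_term)
    fix u assume "u \<in> T"
    then show "leads w (g u) u" "Poly_Mapping.lookup (g u) u = 1" "u \<noteq> x"
      using g insert.hyps(2) by (auto simp: monic_leads_def)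
  qed (use f in \<open>simp add: monic_leads_def\<close>)
  then have lead: "leads w (f + h) x"
    using f by (intro leads_add) (simp_all add: monic_leads_def)
  have deg_h: "total_degree v = d" if v: "v \<in> Poly_Mapping.keys h" for v
  proof -
    have "v \<in> (\<Union>u\<in>T. Poly_Mapping.keys (Poly_Mapping.single 0 (- Poly_Mapping.lookup f u) * g u))"
      by (rule subsetD[OF keys_sum v[unfolded h_def]])
    then obtain u where u: "u \<in> T"
        "v \<in> Poly_Mapping.keys (Poly_Mapping.single 0 (- Poly_Mapping.lookup f u) * g u)"
      by (rule UN_E)
    then have "v \<in> Poly_Mapping.keys (g u)"
      using keys_single_times_subset[of 0 "- Poly_Mapping.lookup f u" "g u"] by auto
    then show ?thesis
      using g[OF u(1)] by (simp add: monic_leads_def)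
  qed
  have zero: "Poly_Mapping.lookup (f + h) v = 0" if v: "v \<in> T" for v
  proof -
    have "Poly_Mapping.lookup h v = (\<Sum>u\<in>T. if u = v then - Poly_Mapping.lookup f v else 0)"
      unfolding h_def lookup_sum
      using v g0[OF _ v] g1[OF v] by (intro sum.cong) (auto simp: lookup_scalar_times)
    then show ?thesis using v insert.hyps(1) by (simp add: lookup_add)
  qed
  define f' where
    "f' = Poly_Mapping.single 0 (inverse (Poly_Mapping.lookup (f + h) x)) * (f + h)"
  have f': "monic_leads w d x f'"
    unfolding f'_def using f hI lead deg_h keys_add[of f h]
    by (intro monic_leadsI) (auto simp: monic_leads_def add_mem)
  have f'0: "Poly_Mapping.lookup f' v = 0" if "v \<in> T" for v
    using zero[OF that] by (simp add: f'_def lookup_scalar_times)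
  \<comment> \<open>Now \<open>f'\<close> clears \<open>x\<close> from the old polynomials; having
    no exponent in \<open>T\<close>, it brings none of these back.\<close>
  define g' where "g' u =
    (if u = x then f' else g u + Poly_Mapping.single 0 (- Poly_Mapping.lookup (g u) x) * f')" for u
  have "monic_leads w d u (g' u) \<and> (\<forall>v\<in>insert x T. v \<noteq> u \<longrightarrow> Poly_Mapping.lookup (g' u) v = 0)"
    if u: "u \<in> insert x T" for u
  proof (cases "u = x")
    case True
    then show ?thesis using f' f'0 by (auto simp: g'_def)
  next
    case False
    with u have uT: "u \<in> T" by simp
    have g'u: "g' u = g u + Poly_Mapping.single 0 (- Poly_Mapping.lookup (g u) x) * f'"
      using False by (simp add: g'_def)
    have "leads w (g' u) u"
      unfolding g'u using g[OF uT] f' False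
      by (intro leads_add behind_cancel_term) (auto simp: monic_leads_def)
    moreover have "g' u \<in> I"
      unfolding g'u using g[OF uT] f' by (intro add_mem times_mem) (auto simp: monic_leads_def)
    moreover have "total_degree v = d" if "v \<in> Poly_Mapping.keys (g' u)" for v
    proof -
      have "v \<in> Poly_Mapping.keys (g u) \<union> (+) 0 ` Poly_Mapping.keys f'"
        using that subsetD[OF keys_add, of v "g u"]
          subsetD[OF keys_single_times_subset, of v 0 "- Poly_Mapping.lookup (g u) x" f']
        unfolding g'u by auto
      then show ?thesis using g[OF uT] f' by (auto simp: monic_leads_def)
    qed
    moreover have "Poly_Mapping.lookup (g' u) u = 1"
      using g1[OF uT] f'0[OF uT] by (simp add: g'u lookup_add lookup_scalar_times)
    moreover have "Poly_Mapping.lookup (g' u) v = 0" if "v \<in> insert x T" "v \<noteq> u" for v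
    proof (cases "v = x")
      case True
      then show ?thesis using f' by (simp add: g'u lookup_add lookup_scalar_times monic_leads_def)
    next
      case False
      then show ?thesis
        using that g0[OF uT] f'0 by (simp add: g'u lookup_add lookup_scalar_times)
    qed
    ultimately show ?thesis by (simp add: monic_leads_def)
  qed
  then show ?case by blast
qed simp

text \<open>Elimination over all leading exponents of the degree of \<open>u\<close>, which are
  finitely many; the result is homogeneous of that degree and so meets the lead set nowhere
  else.\<close>

lemma ex_reduced:
  assumes "u \<in> lead_set w"
  shows "\<exists>f. reduced (lead_set w) u f"
proof -
  define T where "T = {v \<in> lead_set w. total_degree v = total_degree u}"
  have "finite T" unfolding T_def using finite_total_degree[of "total_degree u"]
    by (rule rev_finite_subset) auto
  then have "\<exists>g. \<forall>u'\<in>T. monic_leads w (total_degree u) u' (g u') \<and>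
      (\<forall>v\<in>T. v \<noteq> u' \<longrightarrow> Poly_Mapping.lookup (g u') v = 0)"
    by (rule reduced_family) (simp add: T_def)
  then obtain g where g: "\<forall>u'\<in>T. monic_leads w (total_degree u) u' (g u') \<and>
      (\<forall>v\<in>T. v \<noteq> u' \<longrightarrow> Poly_Mapping.lookup (g u') v = 0)" ..
  have u: "u \<in> T" using assms by (simp add: T_def)
  have "reduced (lead_set w) u (g u)"
  proof -
    have gu: "monic_leads w (total_degree u) u (g u)"
      and g0: "\<And>v. v \<in> T \<Longrightarrow> v \<noteq> u \<Longrightarrow> Poly_Mapping.lookup (g u) v = 0"
      using g u by auto
    have "v = u" if "v \<in> Poly_Mapping.keys (g u)" "v \<in> lead_set w" for v
    proof (rule ccontr)
      assume "v \<noteq> u"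
      moreover have "v \<in> T" using that gu by (simp add: T_def monic_leads_def)
      ultimately show False using g0 that(1) by (simp add: in_keys_iff)
    qed
    moreover have "u \<in> Poly_Mapping.keys (g u)" using gu by (simp add: monic_leads_def leads_def)
    ultimately show ?thesis
      using gu assms unfolding reduced_def monic_leads_def by blast
  qed
  then show ?thesis by blast
qed

text \<open>A polynomial reduced for an additional exponent \<open>u\<close> would avoid the smaller
  set and hence be 0. This takes the place of a comparison of Hilbert functions.\<close>

lemma lead_set_antisym:
  assumes "lead_set w \<subseteq> lead_set w'"
  shows "lead_set w = lead_set w'"
proof (rule ccontr)
  assume "lead_set w \<noteq> lead_set w'"
  then obtain u where u: "u \<in> lead_set w'" "u \<notin> lead_set w" using assms by blast
  then obtain f where f: "reduced (lead_set w') u f" using ex_reduced by blast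
  then have "f = 0"
    using u assms by (intro eq_0_if_outside_lead_set[of f w]) (auto simp: reduced_def)
  then show False using f by (simp add: reduced_def)
qed

text \<open>A polynomial supported outside of \<open>J\<close> leaves only finitely many possibilities for an
  additional element of a set of leading exponents containing \<open>J\<close>.\<close>

lemma finite_lead_sets: "finite (range lead_set)"
proof -
  have "finite {M \<in> range lead_set. J \<subseteq> M}" if "monomial_ideal J" for J
    using that
  proof (induct J rule: wf_induct_rule[OF wf_monomial_ideals])
    case (1 J)
    show ?case
    proof (cases "\<exists>M\<in>range lead_set. J \<subset> M")
      case True
      then obtain w where "J \<subset> lead_set w" by auto
      then obtain u where u: "J \<subseteq> lead_set w" "u \<in> lead_set w" "u \<notin> J" by blast
      \<comment> \<open>All exponents of \<open>f\<close> are outside of \<open>J\<close>: only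
        \<open>u\<close> is in \<open>lead_set w\<close>, and \<open>u\<close> is not in
        \<open>J\<close>.\<close>
      obtain f where f: "reduced (lead_set w) u f" using ex_reduced[OF u(2)] by blast
      have fI: "f \<in> I" "f \<noteq> 0" using f by (auto simp: reduced_def)
      have outside: "v \<notin> J" if "v \<in> Poly_Mapping.keys f" for v
        using f u that by (auto simp: reduced_def)
      \<comment> \<open>The ideal generated by \<open>J\<close> and \<open>v\<close>. A lead set
        containing \<open>J\<close> also contains the exponent of \<open>f\<close> that leads at its
        own weight vector, hence one of these larger ideals.\<close>
      define J' where "J' v = J \<union> range (\<lambda>a. a + v)" for v
      have "monomial_ideal (J' v)" for v
        using "1.prems" by (auto simp: J'_def monomial_ideal_def add.assoc[symmetric])
      moreover have "J \<subset> J' v" if "v \<in> Poly_Mapping.keys f" for v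
      proof -
        have "v \<in> J' v" unfolding J'_def by (intro UnI2 image_eqI[of _ _ 0]) simp_all
        then show ?thesis using outside[OF that] by (auto simp: J'_def)
      qed
      ultimately have fin: "finite {M \<in> range lead_set. J' v \<subseteq> M}" if "v \<in> Poly_Mapping.keys f" for v
        using "1.hyps"[of "J' v"] "1.prems" that by blast
      have "{M \<in> range lead_set. J \<subseteq> M} \<subseteq>
          (\<Union>v\<in>Poly_Mapping.keys f. {M \<in> range lead_set. J' v \<subseteq> M})"
      proof
        fix M assume M: "M \<in> {M \<in> range lead_set. J \<subseteq> M}"
        then obtain w' where w': "M = lead_set w'" by blast
        obtain v where v: "leads w' f v" using ex_leads[OF fI(2)] .
        then have "v \<in> M" using fI(1) w' by (auto simp: lead_set_def)
        then have "J' v \<subseteq> M"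
          using M w' monomial_ideal_lead_set[of w'] by (auto simp: J'_def monomial_ideal_def)
        then show "M \<in> (\<Union>v\<in>Poly_Mapping.keys f. {M \<in> range lead_set. J' v \<subseteq> M})"
          using M v by (auto simp: leads_def)
      qed
      then show ?thesis by (rule finite_subset) (use fin in simp)
    next
      case False
      then have "{M \<in> range lead_set. J \<subseteq> M} \<subseteq> {J}" by blast
      then show ?thesis by (rule finite_subset) simp
    qed
  qed
  from this[of "{}"] show ?thesis by (simp add: monomial_ideal_def)
qed

end

section \<open>The constraints attached to a set of leading exponents\<close>

text \<open>For a dual family, a projection onto the span of the \<open>e u\<close> with
  \<open>u\<close> in \<open>M\<close>. The coefficient ring is general because this is used over
  the field and over its residue field.\<close>

definition expand ::
    "'b set \<Rightarrow> ('b \<Rightarrow> 'b \<Rightarrow>\<^sub>0 'c) \<Rightarrow> ('b::cancel_comm_monoid_add \<Rightarrow>\<^sub>0 'c::comm_ring_1) \<Rightarrow> 'b \<Rightarrow>\<^sub>0 'c"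
  where "expand M e p =
    (\<Sum>u\<in>Poly_Mapping.keys p \<inter> M. Poly_Mapping.single 0 (Poly_Mapping.lookup p u) * e u)"

definition dual_family :: "'b set \<Rightarrow> ('b \<Rightarrow> 'b \<Rightarrow>\<^sub>0 'c::zero_neq_one) \<Rightarrow> bool"
  where "dual_family M e \<longleftrightarrow>
    (\<forall>u\<in>M. \<forall>v\<in>M. Poly_Mapping.lookup (e u) v = (if v = u then 1 else 0))"

lemma expand_superset:
  assumes "finite U" "Poly_Mapping.keys p \<inter> M \<subseteq> U" "U \<subseteq> M"
  shows "expand M e p = (\<Sum>u\<in>U. Poly_Mapping.single 0 (Poly_Mapping.lookup p u) * e u)"
  unfolding expand_def
proof (rule sum.mono_neutral_left[OF assms(1,2)])
  show "\<forall>u\<in>U - Poly_Mapping.keys p \<inter> M. Poly_Mapping.single 0 (Poly_Mapping.lookup p u) * e u = 0"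
    using assms(3) by (auto simp: in_keys_iff)
qed

lemma expand_add: "expand M e (p + q) = expand M e p + expand M e q"
proof -
  let ?U = "(Poly_Mapping.keys p \<union> Poly_Mapping.keys q) \<inter> M"
  have "expand M e r = (\<Sum>u\<in>?U. Poly_Mapping.single 0 (Poly_Mapping.lookup r u) * e u)"
    if "Poly_Mapping.keys r \<subseteq> Poly_Mapping.keys p \<union> Poly_Mapping.keys q" for r
    using that by (intro expand_superset) auto
  from this[of p] this[of q] this[of "p + q"] show ?thesis
    by (simp add: keys_add lookup_add single_add distrib_right sum.distrib)
qed

lemma expand_zero [simp]: "expand M e 0 = 0"
  by (simp add: expand_def)

lemma lookup_expand:
  assumes "dual_family M e" "v \<in> M"
  shows "Poly_Mapping.lookup (expand M e p) v = Poly_Mapping.lookup p v"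
proof -
  have "Poly_Mapping.lookup (expand M e p) v =
      (\<Sum>u\<in>Poly_Mapping.keys p \<inter> M. if u = v then Poly_Mapping.lookup p v else 0)"
    unfolding expand_def lookup_sum using assms
    by (intro sum.cong) (auto simp: lookup_scalar_times dual_family_def)
  also have "\<dots> = Poly_Mapping.lookup p v"
    using assms(2) by (simp add: in_keys_iff)
  finally show ?thesis .
qed

lemma expand_multiple:
  assumes "dual_family M e" "u \<in> M"
  shows "expand M e (Poly_Mapping.single 0 c * e u) = Poly_Mapping.single 0 c * e u"
proof -
  have "Poly_Mapping.keys (Poly_Mapping.single 0 c * e u) \<inter> M \<subseteq> {u}"
  proof
    fix v assume v: "v \<in> Poly_Mapping.keys (Poly_Mapping.single 0 c * e u) \<inter> M"
    then have "Poly_Mapping.lookup (e u) v \<noteq> 0"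
      by (auto simp: in_keys_iff lookup_scalar_times)
    then show "v \<in> {u}"
      using assms v unfolding dual_family_def by (metis IntD2 singleton_iff)
  qed
  then have "expand M e (Poly_Mapping.single 0 c * e u) =
      (\<Sum>u'\<in>{u}. Poly_Mapping.single 0 (Poly_Mapping.lookup (Poly_Mapping.single 0 c * e u) u') * e u')"
    using assms(2) by (intro expand_superset) auto
  then show ?thesis using assms by (simp add: lookup_scalar_times dual_family_def)
qed

lemma expand_sum_multiples:
  assumes "dual_family M e" "U \<subseteq> M"
  shows "expand M e (\<Sum>u\<in>U. Poly_Mapping.single 0 (c u) * e u) =
    (\<Sum>u\<in>U. Poly_Mapping.single 0 (c u) * e u)"
  using assms(2)
  by (induct U rule: infinite_finite_induct) (auto simp: expand_add expand_multiple[OF assms(1)])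

lemma affine_nonneg_limit:
  fixes a b :: real
  assumes "0 \<le> a" "\<And>s. 0 \<le> s \<Longrightarrow> s < 1 \<Longrightarrow> 0 \<le> (1 - s) * a + s * b"
  shows "0 \<le> b"
proof (rule ccontr)
  assume "\<not> 0 \<le> b"
  then have b: "b < 0" "0 < a - b" using assms(1) by auto
  \<comment> \<open>The parameter at which the affine function takes the negative value
    \<open>b / 2\<close>.\<close>
  define s where "s = (a - b / 2) / (a - b)"
  have "0 \<le> s" "s < 1" using b assms(1) by (auto simp: s_def field_simps)
  then have "0 \<le> (1 - s) * a + s * b" by (rule assms(2))
  also have "\<dots> = a - s * (a - b)" by (simp add: algebra_simps)
  also have "\<dots> = b / 2" using b by (simp add: s_def)
  finally show False using b(1) by simp
qed

section \<open>From the conditions for generators to those for all leading exponents\<close>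

context graded_ideal
begin

text \<open>The choice depends on \<open>M\<close> alone, so weight vectors with the same lead set
  share their polynomials and only finitely many systems arise.\<close>

definition red_poly :: "('n \<Rightarrow>\<^sub>0 nat) set \<Rightarrow> ('n \<Rightarrow>\<^sub>0 nat) \<Rightarrow> ('n, 'a) mpoly"
  where "red_poly M u = (SOME f. reduced M u f)"

definition generators :: "('n \<Rightarrow>\<^sub>0 nat) set \<Rightarrow> ('n \<Rightarrow>\<^sub>0 nat) set"
  where "generators M = (SOME G. finite G \<and> G \<subseteq> M \<and> (\<forall>u\<in>M. \<exists>g\<in>G. \<exists>a. u = a + g))"

text \<open>Its value at \<open>w\<close> compares the term at \<open>v\<close> with the term at
  \<open>u\<close>, whose coefficient 1 has valuation 0; \<open>v = u\<close> gives the zero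
  function.\<close>

definition exponent_constraint ::
    "('n \<Rightarrow>\<^sub>0 nat) set \<Rightarrow> ('n \<Rightarrow>\<^sub>0 nat) \<Rightarrow> ('n \<Rightarrow>\<^sub>0 nat) \<Rightarrow> (real ^ 'n) \<times> real"
  where "exponent_constraint M u v =
    (\<chi> i. real (Poly_Mapping.lookup v i) - real (Poly_Mapping.lookup u i),
     val (Poly_Mapping.lookup (red_poly M u) v))"

definition constraints :: "('n \<Rightarrow>\<^sub>0 nat) set \<Rightarrow> ((real ^ 'n) \<times> real) set"
  where "constraints M =
    (\<Union>u\<in>generators M. exponent_constraint M u ` Poly_Mapping.keys (red_poly M u))"

lemma generators:
  "finite (generators (lead_set w))" "generators (lead_set w) \<subseteq> lead_set w"
  "u \<in> lead_set w \<Longrightarrow> \<exists>g\<in>generators (lead_set w). \<exists>a. u = a + g"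
proof -
  obtain G where "finite G" "G \<subseteq> lead_set w" "\<And>u. u \<in> lead_set w \<Longrightarrow> \<exists>g\<in>G. \<exists>a. u = a + g"
    using monomial_ideal_finitely_generated[OF monomial_ideal_lead_set] by blast
  then have "\<exists>G. finite G \<and> G \<subseteq> lead_set w \<and> (\<forall>u\<in>lead_set w. \<exists>g\<in>G. \<exists>a. u = a + g)"
    by blast
  from someI_ex[OF this] show "finite (generators (lead_set w))"
    "generators (lead_set w) \<subseteq> lead_set w"
    "u \<in> lead_set w \<Longrightarrow> \<exists>g\<in>generators (lead_set w). \<exists>a. u = a + g"
    unfolding generators_def by auto
qed

lemma finite_constraints: "finite (constraints (lead_set w))"
  by (simp add: constraints_def generators)

lemma reduced_red_poly: "u \<in> lead_set w \<Longrightarrow> reduced (lead_set w) u (red_poly (lead_set w) u)"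
  unfolding red_poly_def by (rule someI_ex) (rule ex_reduced)

lemma red_poly:
  assumes "u \<in> lead_set w"
  shows "red_poly (lead_set w) u \<in> I" "Poly_Mapping.lookup (red_poly (lead_set w) u) u = 1"
    "Poly_Mapping.keys (red_poly (lead_set w) u) \<inter> lead_set w = {u}"
    "red_poly (lead_set w) u \<noteq> 0" "u \<in> Poly_Mapping.keys (red_poly (lead_set w) u)"
  using reduced_red_poly[OF assms] by (auto simp: reduced_def)

lemma term_weight_red_poly:
  "u \<in> lead_set w \<Longrightarrow> term_weight z (red_poly (lead_set w) u) u = weight z u"
  by (simp add: term_weight_eq red_poly)

lemma dual_family_red_poly: "dual_family (lead_set w) (red_poly (lead_set w))"
  unfolding dual_family_def
proof (intro ballI)
  fix u v assume uv: "u \<in> lead_set w" "v \<in> lead_set w"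
  show "Poly_Mapping.lookup (red_poly (lead_set w) u) v = (if v = u then 1 else 0)"
  proof (cases "v = u")
    case False
    then have "v \<notin> Poly_Mapping.keys (red_poly (lead_set w) u)"
      using red_poly(3)[OF uv(1)] uv(2) by blast
    then show ?thesis using False by (simp add: in_keys_iff)
  qed (simp add: red_poly uv(1))
qed

text \<open>The difference lies in \<open>I\<close> and has no exponent in the lead set.\<close>

lemma expand_red_poly:
  assumes "f \<in> I"
  shows "expand (lead_set w) (red_poly (lead_set w)) f = f"
proof -
  let ?g = "expand (lead_set w) (red_poly (lead_set w)) f"
  have "?g \<in> I"
    unfolding expand_def by (intro sum_mem times_mem red_poly) auto
  then have "f + - 1 * ?g \<in> I"
    using assms by (intro add_mem times_mem)
  moreover have "Poly_Mapping.keys (f + - 1 * ?g) \<inter> lead_set w = {}"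
    by (auto simp: in_keys_iff lookup_minus lookup_expand[OF dual_family_red_poly])
  ultimately have "f + - 1 * ?g = 0" by (rule eq_0_if_outside_lead_set)
  then show ?thesis by simp
qed

lemma leads_red_poly:
  assumes "u \<in> lead_set w"
  shows "leads w (red_poly (lead_set w) u) u"
proof -
  obtain v where v: "leads w (red_poly (lead_set w) u) v"
    using red_poly(4)[OF assms] by (rule ex_leads)
  then have "v \<in> Poly_Mapping.keys (red_poly (lead_set w) u) \<inter> lead_set w"
    using red_poly(1)[OF assms] by (auto simp: lead_set_def leads_def)
  then show ?thesis using v red_poly(3)[OF assms] by simp
qed

lemma constraint_value_exponent_constraint:
  "constraint_value (exponent_constraint M u v) w = term_weight w (red_poly M u) v - weight w u"
proof -
  have "(\<Sum>i\<in>UNIV. (real (Poly_Mapping.lookup v i) - real (Poly_Mapping.lookup u i)) * w $ i) =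
      weight w v - weight w u"
    unfolding weight_def sum_subtractf[symmetric] by (intro sum.cong) (auto simp: algebra_simps)
  then show ?thesis
    by (simp add: constraint_value_def exponent_constraint_def inner_vec_def term_weight_eq)
qed

lemma self_mem_solutions: "w \<in> solutions (constraints (lead_set w))"
proof -
  have "0 \<le> constraint_value (exponent_constraint (lead_set w) u v) w"
    if "u \<in> generators (lead_set w)" "v \<in> Poly_Mapping.keys (red_poly (lead_set w) u)" for u v
  proof -
    have u: "u \<in> lead_set w" using that(1) generators(2) by blast
    show ?thesis
      using leads_term_weight_le[OF leads_red_poly[OF u] that(2)] u
      by (simp add: constraint_value_exponent_constraint term_weight_red_poly)
  qed
  then show ?thesis by (auto simp: solutions_def constraints_def)
qed

text \<open>Generators give an inclusion of monomial ideals, which \<open>lead_set_antisym\<close>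
  turns into equality.\<close>

lemma lead_set_eqI:
  assumes "\<And>u. u \<in> generators (lead_set w) \<Longrightarrow> leads z (red_poly (lead_set w) u) u"
  shows "lead_set z = lead_set w"
proof -
  have "lead_set w \<subseteq> lead_set z"
  proof
    fix u assume "u \<in> lead_set w"
    then obtain g a where g: "g \<in> generators (lead_set w)" "u = a + g"
      using generators(3) by blast
    then have "g \<in> lead_set z"
      using assms[OF g(1)] red_poly(1) generators(2) unfolding lead_set_def by blast
    then show "u \<in> lead_set z"
      using monomial_ideal_lead_set[of z] g(2) by (auto simp: monomial_ideal_def)
  qed
  then show ?thesis using lead_set_antisym by blast
qed

text \<open>On the half-open segment from \<open>w\<close> to a solution \<open>z\<close> the ties are ties at \<open>w\<close>, so the
  set of leading exponents stays the same.\<close>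

lemma constraint_nonneg:
  assumes z: "z \<in> solutions (constraints (lead_set w))"
    and u: "u \<in> lead_set w" "v \<in> Poly_Mapping.keys (red_poly (lead_set w) u)"
  shows "0 \<le> constraint_value (exponent_constraint (lead_set w) u v) z"
\<comment> \<open>At \<open>z\<close> itself the lead set may change, so the inequality is shown
  before the end of the segment and passes to the limit.\<close>
proof (rule affine_nonneg_limit)
  let ?M = "lead_set w"
  show "0 \<le> constraint_value (exponent_constraint ?M u v) w"
    using leads_term_weight_le[OF leads_red_poly[OF u(1)] u(2)] u(1)
    by (simp add: constraint_value_exponent_constraint term_weight_red_poly)
  fix s :: real assume s: "0 \<le> s" "s < 1"
  define x where "x = (1 - s) *\<^sub>R w + s *\<^sub>R z"
  have "leads x (red_poly ?M g) g" if g: "g \<in> generators ?M" for g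
    unfolding leads_def
  proof (intro conjI ballI impI)
    have gM: "g \<in> ?M" using g generators(2) by blast
    show "g \<in> Poly_Mapping.keys (red_poly ?M g)" by (rule red_poly(5)[OF gM])
    fix v' assume v': "v' \<in> Poly_Mapping.keys (red_poly ?M g)" "v' \<noteq> g"
    let ?c = "exponent_constraint ?M g v'"
    have "?c \<in> constraints ?M" using g v'(1) by (auto simp: constraints_def)
    then have z0: "0 \<le> constraint_value ?c z" using z by (simp add: solutions_def)
    have "precedes (sort_key w (red_poly ?M g) g) (sort_key w (red_poly ?M g) v')"
      using leads_red_poly[OF gM] v' by (simp add: leads_def)
    then have "0 < constraint_value ?c w \<or> constraint_value ?c w = 0 \<and> mono_rank g < mono_rank v'"
      by (auto simp: precedes_def sort_key_def constraint_value_exponent_constraint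
          term_weight_red_poly[OF gM])
    \<comment> \<open>A strict inequality at \<open>w\<close> stays strict since
      \<open>s < 1\<close>; a tie at \<open>w\<close> was already decided by rank.\<close>
    then have "0 < constraint_value ?c x \<or> 0 \<le> constraint_value ?c x \<and> mono_rank g < mono_rank v'"
      unfolding x_def constraint_value_combination using z0 s
      by (auto intro: add_pos_nonneg)
    then show "precedes (sort_key x (red_poly ?M g) g) (sort_key x (red_poly ?M g) v')"
      by (auto simp: precedes_def sort_key_def constraint_value_exponent_constraint
          term_weight_red_poly[OF gM])
  qed
  then have eq: "lead_set x = ?M" by (rule lead_set_eqI)
  \<comment> \<open>Equality of the lead sets gives this for every \<open>u\<close> in
    \<open>?M\<close>, although only generators were checked.\<close>
  have "leads x (red_poly ?M u) u"
    using leads_red_poly[of u x] u(1) unfolding eq .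
  from leads_term_weight_le[OF this u(2)] have "0 \<le> constraint_value (exponent_constraint ?M u v) x"
    using u(1) by (simp add: constraint_value_exponent_constraint term_weight_red_poly)
  then show "0 \<le> (1 - s) * constraint_value (exponent_constraint ?M u v) w +
      s * constraint_value (exponent_constraint ?M u v) z"
    by (simp add: x_def constraint_value_combination)
qed

end

section \<open>Initial forms as reductions\<close>

lemma residue_eq_0_iff: "a \<in> valuation_ring \<Longrightarrow> residue a = 0 \<longleftrightarrow> a \<in> maximal_ideal"
  using residue_eq_iff[of a 0] by (simp add: residue_0)

lemma (in rational_subspace) weight_mem: "w \<in> points \<Longrightarrow> weight w u \<in> \<Gamma>"
  unfolding weight_def points_def
  by (intro sum_mem) (auto intro: nat_mult_mem simp: mult.commute[of "w $ _"])

locale groebner_setting = graded_ideal I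
  for I :: "('n::finite, 'a::valued_field) mpoly set" +
  fixes t :: "real \<Rightarrow> 'a"
  assumes rationals: "\<rat> \<subseteq> value_group TYPE('a)"
    and divisible: "divisible (value_group TYPE('a))"
    and splitting: "splitting t"
begin

lemma val_mem: "(a::'a) \<noteq> 0 \<Longrightarrow> val a \<in> value_group TYPE('a)"
  by (simp add: value_group_def)

sublocale rat: rational_subspace "value_group TYPE('a)"
proof
  fix x y assume "x \<in> value_group TYPE('a)" "y \<in> value_group TYPE('a)"
  then obtain a b :: 'a where ab: "a \<noteq> 0" "val a = x" "b \<noteq> 0" "val b = y"
    by (auto simp: value_group_def)
  then show "x + y \<in> value_group TYPE('a)" using val_mem[of "a * b"] by (simp add: val_mult)
  show "- x \<in> value_group TYPE('a)" using val_mem[of "inverse a"] ab by (simp add: val_inverse)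
qed (use rationals divisible in auto)

lemma value_points_eq: "value_points TYPE('a) = rat.points"
  by (simp add: value_points_def rat.points_def)

lemma t_nonzero: "v \<in> value_group TYPE('a) \<Longrightarrow> t v \<noteq> 0"
  and val_t: "v \<in> value_group TYPE('a) \<Longrightarrow> val (t v) = v"
  and t_add: "v \<in> value_group TYPE('a) \<Longrightarrow> v' \<in> value_group TYPE('a) \<Longrightarrow> t (v + v') = t v * t v'"
  using splitting by (auto simp: splitting_def)

lemma t_zero: "t 0 = 1"
  using t_add[of 0 0] t_nonzero[of 0] rat.zero_mem by simp

lemma t_mult_mem:
  assumes "v \<in> value_group TYPE('a)" "c \<noteq> 0 \<Longrightarrow> - v \<le> val c"
  shows "t v * c \<in> valuation_ring"
  using assms t_nonzero[of v]
  by (cases "c = 0") (auto simp: valuation_ring_def val_mult val_t)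

lemma residue_t_mult_eq_0_iff:
  assumes "v \<in> value_group TYPE('a)" "c \<noteq> 0 \<Longrightarrow> - v \<le> val c"
  shows "residue (t v * c) = 0 \<longleftrightarrow> c = 0 \<or> - v < val c"
  using residue_eq_0_iff[OF t_mult_mem[OF assms]] t_nonzero[OF assms(1)] assms(1)
  by (cases "c = 0") (auto simp: maximal_ideal_def val_mult val_t)

definition bounded_below :: "real ^ 'n \<Rightarrow> real \<Rightarrow> ('n, 'a) mpoly \<Rightarrow> bool"
  where "bounded_below w W f \<longleftrightarrow> (\<forall>u\<in>Poly_Mapping.keys f. W \<le> term_weight w f u)"

text \<open>The coefficientwise residue of t^(-W) f(t^w x). For fixed \<open>W\<close> it is
  additive on polynomials bounded below by \<open>W\<close>, unlike \<open>initial_form\<close>,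
  which normalizes each polynomial by its own \<open>trop\<close>.\<close>

definition reduction :: "real ^ 'n \<Rightarrow> real \<Rightarrow> ('n, 'a) mpoly \<Rightarrow> ('n, 'a residue_field) mpoly"
  where "reduction w W f = Poly_Mapping.mapp (\<lambda>u c. residue (t (weight w u - W) * c)) f"

lemma lookup_reduction:
  "Poly_Mapping.lookup (reduction w W f) u =
    residue (t (weight w u - W) * Poly_Mapping.lookup f u)"
  by (simp add: reduction_def lookup_mapp when_def in_keys_iff residue_0)

lemma bounded_below_lookup:
  "bounded_below w W f \<Longrightarrow> Poly_Mapping.lookup f u \<noteq> 0 \<Longrightarrow>
    - (weight w u - W) \<le> val (Poly_Mapping.lookup f u)"
  by (auto simp: bounded_below_def in_keys_iff term_weight_eq algebra_simps dest!: bspec[of _ _ u])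

lemma bounded_below_coeff_mem:
  assumes "w \<in> rat.points" "W \<in> value_group TYPE('a)" "bounded_below w W f"
  shows "t (weight w u - W) * Poly_Mapping.lookup f u \<in> valuation_ring"
  using assms by (intro t_mult_mem bounded_below_lookup) (auto intro: rat.diff_mem rat.weight_mem)

lemma bounded_below_add:
  assumes "bounded_below w W f" "bounded_below w W g"
  shows "bounded_below w W (f + g)"
  unfolding bounded_below_def
proof
  fix u assume "u \<in> Poly_Mapping.keys (f + g)"
  then have nz: "Poly_Mapping.lookup f u + Poly_Mapping.lookup g u \<noteq> 0"
    by (simp add: in_keys_iff lookup_add)
  have "W \<le> val (Poly_Mapping.lookup f u + Poly_Mapping.lookup g u) + weight w u"
  proof (cases "Poly_Mapping.lookup f u = 0 \<or> Poly_Mapping.lookup g u = 0")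
    case True
    then show ?thesis
      using nz bounded_below_lookup[OF assms(1), of u] bounded_below_lookup[OF assms(2), of u] by auto
  next
    case False
    then show ?thesis
      using nz val_add[of "Poly_Mapping.lookup f u" "Poly_Mapping.lookup g u"]
        bounded_below_lookup[OF assms(1), of u] bounded_below_lookup[OF assms(2), of u]
      by (auto simp: min_le_iff_disj)
  qed
  then show "W \<le> term_weight w (f + g) u" by (simp add: term_weight_eq lookup_add)
qed

lemma bounded_below_zero: "bounded_below w W 0"
  by (simp add: bounded_below_def)

lemma bounded_below_sum:
  "(\<And>x. x \<in> A \<Longrightarrow> bounded_below w W (f x)) \<Longrightarrow> bounded_below w W (sum f A)"
  by (induct A rule: infinite_finite_induct) (auto intro: bounded_below_zero bounded_below_add)

lemma reduction_zero [simp]: "reduction w W 0 = 0"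
  by (rule poly_mapping_eqI) (simp add: lookup_reduction residue_0)

lemma reduction_add:
  assumes "w \<in> rat.points" "W \<in> value_group TYPE('a)" "bounded_below w W f" "bounded_below w W g"
  shows "reduction w W (f + g) = reduction w W f + reduction w W g"
  by (rule poly_mapping_eqI)
    (simp add: lookup_reduction lookup_add distrib_left residue_add bounded_below_coeff_mem assms)

lemma reduction_sum:
  assumes "w \<in> rat.points" "W \<in> value_group TYPE('a)" "\<And>x. x \<in> A \<Longrightarrow> bounded_below w W (f x)"
  shows "reduction w W (sum f A) = (\<Sum>x\<in>A. reduction w W (f x))"
  using assms(3)
  by (induct A rule: infinite_finite_induct)
    (simp_all add: reduction_add[OF assms(1,2)] bounded_below_sum)

lemma bounded_below_single_times:
  assumes "bounded_below w W f" "c \<noteq> 0 \<Longrightarrow> W' \<le> val c + weight w a + W"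
  shows "bounded_below w W' (Poly_Mapping.single a c * f)"
proof (cases "c = 0")
  case False
  show ?thesis
    unfolding bounded_below_def
  proof
    fix v' assume "v' \<in> Poly_Mapping.keys (Poly_Mapping.single a c * f)"
    then obtain v where v: "v \<in> Poly_Mapping.keys f" "v' = a + v"
      using False by (auto simp: keys_single_times)
    then have "W \<le> term_weight w f v" using assms(1) by (simp add: bounded_below_def)
    then show "W' \<le> term_weight w (Poly_Mapping.single a c * f) v'"
      using assms(2)[OF False] v(2) term_weight_single_times[OF False v(1), of w a] by simp
  qed
qed (simp add: bounded_below_zero)

text \<open>The splitting is multiplicative, so the twist at \<open>a + v\<close> is distributed
  over the monomial and \<open>f\<close>. If \<open>W'\<close> is strictly below the bound, the
  residue in front is 0.\<close>

lemma reduction_single_times: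
  assumes w: "w \<in> rat.points" "W \<in> value_group TYPE('a)" "W' \<in> value_group TYPE('a)" and f: "bounded_below w W f"
    and c: "c \<noteq> 0 \<Longrightarrow> W' \<le> val c + weight w a + W"
  shows "reduction w W' (Poly_Mapping.single a c * f) =
    Poly_Mapping.single a (residue (t (weight w a + W - W') * c)) * reduction w W f"
proof (rule poly_mapping_eqI)
  fix v'
  let ?r = "residue (t (weight w a + W - W') * c)"
  show "Poly_Mapping.lookup (reduction w W' (Poly_Mapping.single a c * f)) v' =
      Poly_Mapping.lookup (Poly_Mapping.single a ?r * reduction w W f) v'"
  proof (cases "v' \<in> range ((+) a)")
    case True
    then obtain v where v: "v' = a + v" by blast
    have mem: "weight w a + W - W' \<in> value_group TYPE('a)" "weight w v - W \<in> value_group TYPE('a)"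
      using w by (auto intro: rat.add_mem rat.diff_mem rat.weight_mem)
    have "t (weight w v' - W') = t (weight w a + W - W') * t (weight w v - W)"
      using t_add[OF mem] by (simp add: v weight_add algebra_simps)
    then have "t (weight w v' - W') * (c * Poly_Mapping.lookup f v) =
        (t (weight w a + W - W') * c) * (t (weight w v - W) * Poly_Mapping.lookup f v)"
      by (simp only: mult_ac)
    moreover have "t (weight w a + W - W') * c \<in> valuation_ring"
      using mem(1) c by (intro t_mult_mem) auto
    ultimately have "residue (t (weight w v' - W') * (c * Poly_Mapping.lookup f v)) =
        ?r * residue (t (weight w v - W) * Poly_Mapping.lookup f v)"
      using residue_mult bounded_below_coeff_mem[OF w(1,2) f, of v] by metis
    then show ?thesis by (simp add: v lookup_single_times lookup_reduction)
  next
    case False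
    then have "v' \<notin> Poly_Mapping.keys (Poly_Mapping.single a c * f)"
      "v' \<notin> Poly_Mapping.keys (Poly_Mapping.single a ?r * reduction w W f)"
      using keys_single_times_subset by blast+
    then show ?thesis by (simp add: in_keys_iff lookup_reduction residue_0)
  qed
qed

lemma lookup_initial_form:
  "Poly_Mapping.lookup (initial_form t w f) u =
    (if u \<in> Poly_Mapping.keys f \<and> term_weight w f u = trop f w
     then residue (t (- val (Poly_Mapping.lookup f u)) * Poly_Mapping.lookup f u) else 0)"
  by (auto simp: initial_form_def lookup_sum lookup_single when_def sum.delta)

lemma keys_initial_form:
  "Poly_Mapping.keys (initial_form t w f) = {u \<in> Poly_Mapping.keys f. term_weight w f u = trop f w}"
proof -
  have "residue (t (- val c) * c) \<noteq> 0" if "c \<noteq> 0" for c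
    using that residue_t_mult_eq_0_iff[of "- val c" c] rat.uminus_mem[OF val_mem[OF that]] by simp
  then show ?thesis by (auto simp: in_keys_iff[of _ "initial_form t w f"] lookup_initial_form in_keys_iff
      split: if_splits)
qed

lemma trop_attained:
  assumes "f \<noteq> 0"
  obtains u where "u \<in> Poly_Mapping.keys f" "term_weight w f u = trop f w"
proof -
  have "trop f w \<in> term_weight w f ` Poly_Mapping.keys f"
    unfolding trop_def using assms by (intro Min_in) auto
  then show thesis using that by auto
qed

lemma initial_form_nonzero:
  fixes f :: "('n, 'a) mpoly" and w :: "real ^ 'n"
  assumes "f \<noteq> 0"
  shows "initial_form t w f \<noteq> 0"
proof -
  obtain u where "u \<in> Poly_Mapping.keys f" "term_weight w f u = trop f w"
    using trop_attained[OF assms] .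
  then have "u \<in> Poly_Mapping.keys (initial_form t w f)" by (simp add: keys_initial_form)
  then show ?thesis by auto
qed

lemma bounded_below_trop: "bounded_below w (trop f w) f"
  by (simp add: bounded_below_def trop_def)

lemma trop_eqI:
  assumes "bounded_below w W f" "u \<in> Poly_Mapping.keys f" "term_weight w f u = W"
  shows "trop f w = W"
  unfolding trop_def using assms by (intro Min_eqI) (auto simp: bounded_below_def)

lemma trop_mem:
  fixes f :: "('n, 'a) mpoly"
  assumes "f \<noteq> 0" "w \<in> rat.points"
  shows "trop f w \<in> value_group TYPE('a)"
proof -
  obtain u where u: "u \<in> Poly_Mapping.keys f" "term_weight w f u = trop f w"
    using trop_attained[OF assms(1)] .
  have "term_weight w f u \<in> value_group TYPE('a)"
    unfolding term_weight_eq using u(1) assms(2)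
    by (intro rat.add_mem val_mem rat.weight_mem) (simp_all add: in_keys_iff)
  then show ?thesis by (simp add: u(2))
qed

text \<open>For terms of minimal weight the twist \<open>weight w u - trop f w\<close> is minus the
  valuation of the coefficient; all other twisted coefficients lie in the maximal ideal.\<close>

lemma initial_form_eq_reduction:
  fixes f :: "('n, 'a) mpoly" and w :: "real ^ 'n"
  assumes "f \<noteq> 0" "w \<in> rat.points"
  shows "initial_form t w f = reduction w (trop f w) f"
proof (rule poly_mapping_eqI)
  fix u
  have mem: "weight w u - trop f w \<in> value_group TYPE('a)"
    using assms by (intro rat.diff_mem rat.weight_mem trop_mem)
  show "Poly_Mapping.lookup (initial_form t w f) u = Poly_Mapping.lookup (reduction w (trop f w) f) u"
  proof (cases "u \<in> Poly_Mapping.keys f \<and> term_weight w f u = trop f w")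
    case True
    then have "weight w u - trop f w = - val (Poly_Mapping.lookup f u)"
      by (simp add: term_weight_eq algebra_simps)
    then show ?thesis using True by (simp add: lookup_initial_form lookup_reduction)
  next
    case False
    have "residue (t (weight w u - trop f w) * Poly_Mapping.lookup f u) = 0"
      using residue_t_mult_eq_0_iff[OF mem bounded_below_lookup[OF bounded_below_trop]]
        False bounded_below_trop[of w f]
      by (auto simp: in_keys_iff term_weight_eq bounded_below_def algebra_simps less_le)
    then show ?thesis using False by (auto simp: lookup_initial_form lookup_reduction)
  qed
qed

lemma initial_form_zero: "initial_form t w 0 = 0"
  by (simp add: initial_form_def)

text \<open>Hence initial forms of elements of \<open>I\<close> are closed under monomial
  multiplication, and the ideal they generate is their linear span.\<close>

lemma initial_form_shift:
  fixes f :: "('n, 'a) mpoly" and w :: "real ^ 'n"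
  assumes "w \<in> rat.points"
  shows "initial_form t w (Poly_Mapping.single a 1 * f) =
    Poly_Mapping.single a 1 * initial_form t w f"
proof (cases "f = 0")
  case False
  let ?g = "Poly_Mapping.single a 1 * f" and ?W = "weight w a + trop f w"
  obtain u where u: "u \<in> Poly_Mapping.keys f" "term_weight w f u = trop f w"
    using trop_attained[OF False] .
  have key: "a + u \<in> Poly_Mapping.keys ?g" using u(1) by (simp add: keys_single_times)
  have "bounded_below w ?W ?g"
    by (rule bounded_below_single_times[OF bounded_below_trop]) simp
  then have trop: "trop ?g w = ?W"
    using u term_weight_single_times[of 1 u f w a] by (intro trop_eqI[OF _ key]) auto
  have mem: "trop f w \<in> value_group TYPE('a)" "?W \<in> value_group TYPE('a)"
    using False assms by (auto intro: trop_mem rat.add_mem rat.weight_mem)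
  have "initial_form t w ?g = reduction w ?W ?g"
    using key trop assms by (subst initial_form_eq_reduction) auto
  also have "\<dots> = Poly_Mapping.single a 1 * reduction w (trop f w) f"
    using reduction_single_times[OF assms mem bounded_below_trop, of 1 a]
    by (simp add: t_zero residue_1)
  finally show ?thesis using False assms by (simp add: initial_form_eq_reduction)
qed (simp add: initial_form_zero)

end

section \<open>Initial ideals and the Groebner complex\<close>

context groebner_setting
begin

lemma bounded_below_red_poly:
  assumes "w \<in> solutions (constraints (lead_set w0))" "u \<in> lead_set w0"
  shows "bounded_below w (weight w u) (red_poly (lead_set w0) u)"
  using constraint_nonneg[OF assms]
  by (simp add: bounded_below_def constraint_value_exponent_constraint)

lemma trop_red_poly:
  assumes "w \<in> solutions (constraints (lead_set w0))" "u \<in> lead_set w0"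
  shows "trop (red_poly (lead_set w0) u) w = weight w u"
  using bounded_below_red_poly[OF assms] red_poly(5)[OF assms(2)] term_weight_red_poly[OF assms(2)]
  by (rule trop_eqI)

definition initial_red_poly ::
    "(real ^ 'n) \<Rightarrow> ('n \<Rightarrow>\<^sub>0 nat) set \<Rightarrow> ('n \<Rightarrow>\<^sub>0 nat) \<Rightarrow> ('n, 'a residue_field) mpoly"
  where "initial_red_poly w M u = initial_form t w (red_poly M u)"

lemma lookup_initial_red_poly_self:
  assumes "u \<in> lead_set w0" "u \<in> Poly_Mapping.keys (initial_red_poly w (lead_set w0) u)"
  shows "Poly_Mapping.lookup (initial_red_poly w (lead_set w0) u) u = 1"
  using assms red_poly(2)[OF assms(1)]
  by (simp add: initial_red_poly_def keys_initial_form lookup_initial_form t_zero residue_1)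

lemma keys_initial_red_poly_subset:
  assumes "u \<in> lead_set w0"
  shows "Poly_Mapping.keys (initial_red_poly w (lead_set w0) u) \<inter> lead_set w0 \<subseteq> {u}"
  using red_poly(3)[OF assms] by (auto simp: initial_red_poly_def keys_initial_form)

lemma self_mem_keys_initial_red_poly:
  assumes "w \<in> solutions (constraints (lead_set w0))" "u \<in> lead_set w0"
  shows "u \<in> Poly_Mapping.keys (initial_red_poly w (lead_set w0) u)"
  using red_poly(5)[OF assms(2)]
  by (simp add: initial_red_poly_def keys_initial_form trop_red_poly[OF assms]
      term_weight_red_poly[OF assms(2)])

text \<open>At a solution the term at \<open>u\<close> has minimal weight, so it survives with
  coefficient 1, and initial forms acquire no new exponents.\<close>

lemma dual_family_initial_red_poly:
  assumes "w \<in> solutions (constraints (lead_set w0))"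
  shows "dual_family (lead_set w0) (initial_red_poly w (lead_set w0))"
  unfolding dual_family_def
proof (intro ballI)
  fix u v assume uv: "u \<in> lead_set w0" "v \<in> lead_set w0"
  show "Poly_Mapping.lookup (initial_red_poly w (lead_set w0) u) v = (if v = u then 1 else 0)"
  proof (cases "v = u")
    case True
    then show ?thesis
      using lookup_initial_red_poly_self[OF uv(1) self_mem_keys_initial_red_poly[OF assms uv(1)]]
      by simp
  next
    case False
    then have "v \<notin> Poly_Mapping.keys (initial_red_poly w (lead_set w0) u)"
      using keys_initial_red_poly_subset[OF uv(1)] uv(2) by blast
    then show ?thesis using False by (simp add: in_keys_iff)
  qed
qed

text \<open>In the expansion of \<open>f\<close>, the summand for \<open>u\<close> attains its least
  weight at \<open>u\<close>, where it is the weight of a term of \<open>f\<close>. So all summands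
  are bounded below by \<open>trop f w\<close> and can be reduced one by one at that level.\<close>

lemma initial_form_as_combination:
  assumes w: "w \<in> rat.points" "w \<in> solutions (constraints (lead_set w0))" and f: "f \<in> I" "f \<noteq> 0"
  shows "initial_form t w f = (\<Sum>u\<in>Poly_Mapping.keys f \<inter> lead_set w0.
    Poly_Mapping.single 0 (residue (t (weight w u - trop f w) * Poly_Mapping.lookup f u)) *
      initial_red_poly w (lead_set w0) u)"
proof -
  let ?M = "lead_set w0"
  let ?U = "Poly_Mapping.keys f \<inter> ?M"
  let ?g = "\<lambda>u. Poly_Mapping.single 0 (Poly_Mapping.lookup f u) * red_poly ?M u"
  have W: "trop f w \<in> value_group TYPE('a)" using f(2) w(1) by (rule trop_mem)
  have coeff: "trop f w \<le> val (Poly_Mapping.lookup f u) + weight w 0 + weight w u"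
    if "Poly_Mapping.lookup f u \<noteq> 0" for u
    using bounded_below_lookup[OF bounded_below_trop that, of w] by simp
  have bound: "bounded_below w (trop f w) (?g u)" if "u \<in> ?M" for u
    using bounded_below_red_poly[OF w(2) that] coeff by (rule bounded_below_single_times)
  have "initial_form t w f = reduction w (trop f w) (\<Sum>u\<in>?U. ?g u)"
    using initial_form_eq_reduction[OF f(2) w(1)] expand_red_poly[OF f(1), of w0]
    by (simp add: expand_def)
  also have "\<dots> = (\<Sum>u\<in>?U. reduction w (trop f w) (?g u))"
    using bound by (intro reduction_sum[OF w(1) W]) blast
  also have "\<dots> = (\<Sum>u\<in>?U.
      Poly_Mapping.single 0 (residue (t (weight w u - trop f w) * Poly_Mapping.lookup f u)) *
        initial_red_poly w ?M u)"
  proof (rule sum.cong[OF refl])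
    fix u assume "u \<in> ?U"
    then have u: "u \<in> ?M" by blast
    have "initial_red_poly w ?M u = reduction w (weight w u) (red_poly ?M u)"
      unfolding initial_red_poly_def
      by (simp add: initial_form_eq_reduction[OF red_poly(4)[OF u] w(1)] trop_red_poly[OF w(2) u])
    moreover have "reduction w (trop f w) (?g u) =
        Poly_Mapping.single 0
          (residue (t (weight w 0 + weight w u - trop f w) * Poly_Mapping.lookup f u)) *
        reduction w (weight w u) (red_poly ?M u)"
      using rat.weight_mem[OF w(1)] W bounded_below_red_poly[OF w(2) u] coeff
      by (intro reduction_single_times w(1))
    ultimately show "reduction w (trop f w) (?g u) =
        Poly_Mapping.single 0 (residue (t (weight w u - trop f w) * Poly_Mapping.lookup f u)) *
        initial_red_poly w ?M u" by simp
  qed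
  finally show ?thesis .
qed

lemma expand_initial_form:
  assumes w: "w \<in> rat.points" "w \<in> solutions (constraints (lead_set w0))" and f: "f \<in> I"
  shows "expand (lead_set w0) (initial_red_poly w (lead_set w0))
      (Poly_Mapping.single 0 c * initial_form t w f) = Poly_Mapping.single 0 c * initial_form t w f"
proof (cases "f = 0")
  case False
  let ?r = "\<lambda>u. residue (t (weight w u - trop f w) * Poly_Mapping.lookup f u)"
  have "Poly_Mapping.single 0 c * initial_form t w f =
      (\<Sum>u\<in>Poly_Mapping.keys f \<inter> lead_set w0.
        Poly_Mapping.single 0 (c * ?r u) * initial_red_poly w (lead_set w0) u)"
    unfolding initial_form_as_combination[OF w f False] sum_distrib_left mult.assoc[symmetric]
      mult_single by simp
  then show ?thesis
    using expand_sum_multiples[OF dual_family_initial_red_poly[OF w(2)]] by simp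
qed (simp add: initial_form_zero)

text \<open>The monomial moves inside the initial form, the scalar stays outside. So the initial
  forms of the \<open>red_poly\<close> span the initial ideal at every solution, even where
  \<open>lead_set w\<close> differs from \<open>lead_set w0\<close>.\<close>

lemma expand_initial_ideal:
  assumes w: "w \<in> rat.points" "w \<in> solutions (constraints (lead_set w0))"
    and "p \<in> initial_ideal t w I"
  shows "expand (lead_set w0) (initial_red_poly w (lead_set w0)) p = p"
  using assms(3) unfolding initial_ideal_def
proof (induct rule: ideal_span_monomial_induct)
  case (add x y)
  then show ?case by (simp add: expand_add)
next
  case (monomial a c h)
  then obtain f where f: "f \<in> I" "h = initial_form t w f" by blast
  have "Poly_Mapping.single a c * h =
      Poly_Mapping.single 0 c * (Poly_Mapping.single a 1 * initial_form t w f)"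
    by (simp add: f(2) mult.assoc[symmetric] mult_single)
  also have "\<dots> = Poly_Mapping.single 0 c * initial_form t w (Poly_Mapping.single a 1 * f)"
    by (simp only: initial_form_shift[OF w(1)])
  finally show ?case
    using expand_initial_form[OF w times_mem[OF f(1)], of c "Poly_Mapping.single a 1"] by simp
qed simp

lemma initial_red_poly_mem:
  "u \<in> lead_set w0 \<Longrightarrow> initial_red_poly w (lead_set w0) u \<in> initial_ideal t w I"
  unfolding initial_ideal_def initial_red_poly_def by (intro ideal.span_base imageI red_poly(1))

lemma initial_ideal_mono:
  assumes w: "w \<in> rat.points" "w \<in> solutions (constraints (lead_set w0))"
    and eq: "\<And>u. u \<in> lead_set w0 \<Longrightarrow>
      initial_red_poly w (lead_set w0) u = initial_red_poly y (lead_set w0) u"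
  shows "initial_ideal t w I \<subseteq> initial_ideal t y I"
proof
  fix p assume "p \<in> initial_ideal t w I"
  then have "p = (\<Sum>u\<in>Poly_Mapping.keys p \<inter> lead_set w0.
      Poly_Mapping.single 0 (Poly_Mapping.lookup p u) * initial_red_poly w (lead_set w0) u)"
    using expand_initial_ideal[OF w] by (simp add: expand_def)
  moreover have "(\<Sum>u\<in>Poly_Mapping.keys p \<inter> lead_set w0.
      Poly_Mapping.single 0 (Poly_Mapping.lookup p u) * initial_red_poly w (lead_set w0) u)
      \<in> initial_ideal t y I"
    using initial_red_poly_mem[of _ w0 y] eq unfolding initial_ideal_def
    by (intro ideal.span_sum ideal.span_scale) auto
  ultimately show "p \<in> initial_ideal t y I" by simp
qed

text \<open>The point \<open>y\<close> may lie outside of the solution set. Its initial form is a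
  nonzero element of the common ideal, in which only 0 avoids the lead set, so it contains
  \<open>u\<close>. Both initial forms then have coefficient 1 at \<open>u\<close>, and their
  difference avoids the lead set.\<close>

lemma initial_red_poly_eq_if_initial_ideal_eq:
  assumes w: "w \<in> rat.points" "w \<in> solutions (constraints (lead_set w0))"
    and eq: "initial_ideal t y I = initial_ideal t w I" and u: "u \<in> lead_set w0"
  shows "initial_red_poly y (lead_set w0) u = initial_red_poly w (lead_set w0) u"
    and "u \<in> Poly_Mapping.keys (initial_red_poly y (lead_set w0) u)"
proof -
  let ?M = "lead_set w0"
  let ?p = "initial_red_poly y ?M u" and ?q = "initial_red_poly w ?M u"
  have vanish: "r = 0" if "r \<in> initial_ideal t w I" "Poly_Mapping.keys r \<inter> ?M = {}" for r
    using expand_initial_ideal[OF w that(1)] that(2) by (simp add: expand_def)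
  have mem: "?p \<in> initial_ideal t w I" "?q \<in> initial_ideal t w I"
    using initial_red_poly_mem[OF u] eq by blast+
  have "?p \<noteq> 0"
    unfolding initial_red_poly_def by (rule initial_form_nonzero[OF red_poly(4)[OF u]])
  then show key: "u \<in> Poly_Mapping.keys ?p"
    using vanish[OF mem(1)] keys_initial_red_poly_subset[OF u, of y] by blast
  have "?p + - 1 * ?q \<in> initial_ideal t w I"
    using mem unfolding initial_ideal_def by (intro ideal.span_add ideal.span_scale)
  moreover have "Poly_Mapping.keys (?p + - 1 * ?q) \<inter> ?M = {}"
  proof (rule equals0I)
    fix v assume v: "v \<in> Poly_Mapping.keys (?p + - 1 * ?q) \<inter> ?M"
    then have nz: "Poly_Mapping.lookup ?p v \<noteq> Poly_Mapping.lookup ?q v" "v \<in> ?M"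
      by (auto simp: in_keys_iff lookup_minus)
    then have "v \<in> Poly_Mapping.keys ?p \<or> v \<in> Poly_Mapping.keys ?q"
      by (metis in_keys_iff)
    then have "v = u"
      using keys_initial_red_poly_subset[OF u, of y] keys_initial_red_poly_subset[OF u, of w] nz(2)
      by blast
    then show False
      using nz(1) lookup_initial_red_poly_self[OF u key]
        lookup_initial_red_poly_self[OF u self_mem_keys_initial_red_poly[OF w(2) u]] by simp
  qed
  ultimately have "?p + - 1 * ?q = 0" by (rule vanish)
  then show "?p = ?q" by simp
qed

lemma keys_initial_red_poly:
  assumes "w \<in> solutions (constraints (lead_set w0))" "u \<in> lead_set w0"
  shows "Poly_Mapping.keys (initial_red_poly w (lead_set w0) u) =
    {v \<in> Poly_Mapping.keys (red_poly (lead_set w0) u).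
      constraint_value (exponent_constraint (lead_set w0) u v) w = 0}"
  by (auto simp: initial_red_poly_def keys_initial_form trop_red_poly[OF assms]
      constraint_value_exponent_constraint)

text \<open>The weight vector decides which exponents occur in an initial form, but not the
  coefficients they carry.\<close>

lemma initial_red_poly_cong:
  assumes "Poly_Mapping.keys (initial_red_poly w M u) = Poly_Mapping.keys (initial_red_poly y M u)"
  shows "initial_red_poly w M u = initial_red_poly y M u"
proof (rule poly_mapping_eqI)
  fix v
  show "Poly_Mapping.lookup (initial_red_poly w M u) v = Poly_Mapping.lookup (initial_red_poly y M u) v"
  proof (cases "v \<in> Poly_Mapping.keys (initial_red_poly w M u)")
    case True
    moreover from this have "v \<in> Poly_Mapping.keys (initial_red_poly y M u)" using assms by simp
    ultimately show ?thesis by (simp add: initial_red_poly_def lookup_initial_form keys_initial_form)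
  next
    case False
    moreover from this have "v \<notin> Poly_Mapping.keys (initial_red_poly y M u)" using assms by simp
    ultimately show ?thesis by (simp add: in_keys_iff)
  qed
qed

text \<open>Equal initial ideals force equal initial forms of all \<open>red_poly\<close>, which
  reveal the tight constraints; conversely the tight constraints determine these forms, which span
  the ideal. Boundary solutions \<open>x\<close> are included, as the faces require.\<close>

lemma groebner_class_eq:
  assumes x: "x \<in> rat.points" "x \<in> solutions (constraints (lead_set w0))"
  shows "groebner_class t I x = {y \<in> rat.points. y \<in> solutions (constraints (lead_set w0)) \<and>
    tight (constraints (lead_set w0)) y = tight (constraints (lead_set w0)) x}"
proof (intro equalityI subsetI)
  let ?M = "lead_set w0" and ?H = "constraints (lead_set w0)"
  fix y assume "y \<in> groebner_class t I x"
  then have y: "y \<in> rat.points" "initial_ideal t y I = initial_ideal t x I"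
    by (simp_all add: groebner_class_def value_points_eq)
  have "0 \<le> constraint_value (exponent_constraint ?M u v) y"
    if "u \<in> generators ?M" "v \<in> Poly_Mapping.keys (red_poly ?M u)" for u v
  proof -
    have u: "u \<in> ?M" using that(1) generators(2) by blast
    have "u \<in> Poly_Mapping.keys (initial_red_poly y ?M u)"
      by (rule initial_red_poly_eq_if_initial_ideal_eq(2)[OF x y(2) u])
    \<comment> \<open>Occurring in the initial form, \<open>u\<close> has minimal weight at
      \<open>y\<close>; this is what the conditions for \<open>u\<close> say.\<close>
    then have "trop (red_poly ?M u) y = weight y u"
      by (simp add: initial_red_poly_def keys_initial_form term_weight_red_poly[OF u])
    then show ?thesis
      using bounded_below_trop[of y "red_poly ?M u"] that(2)
      by (simp add: bounded_below_def constraint_value_exponent_constraint)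
  qed
  then have sol: "y \<in> solutions ?H" by (auto simp: solutions_def constraints_def)
  have "constraint_value (exponent_constraint ?M u v) y = 0 \<longleftrightarrow>
      constraint_value (exponent_constraint ?M u v) x = 0"
    if "u \<in> generators ?M" "v \<in> Poly_Mapping.keys (red_poly ?M u)" for u v
  proof -
    have u: "u \<in> ?M" using that(1) generators(2) by blast
    have "Poly_Mapping.keys (initial_red_poly y ?M u) = Poly_Mapping.keys (initial_red_poly x ?M u)"
      using initial_red_poly_eq_if_initial_ideal_eq(1)[OF x y(2) u] by simp
    then show ?thesis
      using that(2) unfolding keys_initial_red_poly[OF sol u] keys_initial_red_poly[OF x(2) u]
      by blast
  qed
  then have "tight ?H y = tight ?H x" by (auto simp: tight_def constraints_def)
  then show "y \<in> {y \<in> rat.points. y \<in> solutions ?H \<and> tight ?H y = tight ?H x}"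
    using y(1) sol by simp
next
  let ?M = "lead_set w0" and ?H = "constraints (lead_set w0)"
  fix y assume "y \<in> {y \<in> rat.points. y \<in> solutions ?H \<and> tight ?H y = tight ?H x}"
  then have y: "y \<in> rat.points" "y \<in> solutions ?H" and tight: "tight ?H y = tight ?H x" by auto
  \<comment> \<open>Tightness is given for generators only. Each point lies in the cell of the
    other, and the conditions for any \<open>u\<close> in \<open>?M\<close> are nonnegative on all
    solutions, so they vanish at both points or at neither.\<close>
  have cells: "y \<in> cell ?H x" "x \<in> cell ?H y"
    using x(2) y(2) tight by (auto simp: cell_def)
  have eq: "initial_red_poly x ?M u = initial_red_poly y ?M u" if u: "u \<in> ?M" for u
  proof (rule initial_red_poly_cong)
    have "constraint_value (exponent_constraint ?M u v) x = 0 \<longleftrightarrow>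
        constraint_value (exponent_constraint ?M u v) y = 0"
      if v: "v \<in> Poly_Mapping.keys (red_poly ?M u)" for v
      using affine_vanishing_on_cell[OF finite_constraints x(2) cells(1) constraint_nonneg[OF _ u v]]
        affine_vanishing_on_cell[OF finite_constraints y(2) cells(2) constraint_nonneg[OF _ u v]]
      by blast
    then show "Poly_Mapping.keys (initial_red_poly x ?M u) = Poly_Mapping.keys (initial_red_poly y ?M u)"
      unfolding keys_initial_red_poly[OF x(2) u] keys_initial_red_poly[OF y(2) u] by blast
  qed
  have "initial_ideal t y I = initial_ideal t x I"
    using initial_ideal_mono[OF x eq] initial_ideal_mono[OF y eq[symmetric]] by blast
  then show "y \<in> groebner_class t I x"
    using y(1) by (simp add: groebner_class_def value_points_eq)
qed

lemma rational_constraints: "rat.rational_constraints (constraints (lead_set w))"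
  unfolding rat.rational_constraints_def
proof
  fix c assume "c \<in> constraints (lead_set w)"
  then obtain u v where "v \<in> Poly_Mapping.keys (red_poly (lead_set w) u)"
    "c = exponent_constraint (lead_set w) u v"
    by (auto simp: constraints_def)
  then show "(\<forall>i. fst c $ i \<in> \<rat>) \<and> snd c \<in> value_group TYPE('a)"
    by (simp add: exponent_constraint_def val_mem in_keys_iff)
qed

lemma groebner_complex:
  "finite (groebner_cells t I)" "polyhedral_complex (groebner_cells t I)"
  "\<forall>P\<in>groebner_cells t I. rational_polyhedron (value_group TYPE('a)) P"
proof -
  have classes: "\<exists>H\<in>constraints ` range lead_set. w \<in> solutions H \<and>
      (\<forall>x\<in>rat.points \<inter> solutions H. groebner_class t I x =
        {y \<in> rat.points. y \<in> solutions H \<and> tight H y = tight H x})"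
    if "w \<in> rat.points" for w
    using self_mem_solutions[of w] groebner_class_eq by auto
  have constraints: "finite H \<and> rat.rational_constraints H" if "H \<in> constraints ` range lead_set" for H
    using that finite_constraints rational_constraints by auto
  have "finite (constraints ` range lead_set)"
    using finite_lead_sets by (rule finite_imageI)
  note complex = rat.polyhedral_complex_of_classes[OF this constraints classes]
  have "groebner_cells t I = {closure (groebner_class t I w) | w. w \<in> rat.points}"
    by (simp add: groebner_cells_def value_points_eq)
  then show "finite (groebner_cells t I)" "polyhedral_complex (groebner_cells t I)"
    "\<forall>P\<in>groebner_cells t I. rational_polyhedron (value_group TYPE('a)) P"
    using complex by simp_all
qed

end

theorem theorem2p4:
  fixes t :: "real \<Rightarrow> 'a::valued_field"
    and I :: "('n::finite, 'a) mpoly set"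
  assumes nontrivial: "\<exists>a::'a. a \<noteq> 0 \<and> val a \<noteq> 0"
    and dense: "closure (value_group TYPE('a)) = UNIV"
    and rationals: "\<rat> \<subseteq> value_group TYPE('a)"
    and divisible: "divisible (value_group TYPE('a))"
    and splitting: "splitting t"
    and homogeneous: "homogeneous_ideal I"
  shows "finite (groebner_cells t I) \<and> polyhedral_complex (groebner_cells t I) \<and>
    (\<forall>P\<in>groebner_cells t I. rational_polyhedron (value_group TYPE('a)) P)"
proof -
  interpret groebner_setting I t
    using homogeneous rationals divisible splitting by unfold_locales
  show ?thesis using groebner_complex by blast
qed

end
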